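(* Let $\Theta$ be an inner function on the open unit disk $\mathbb{D}$, let $\mathcal{K}_{\Theta} = H^2 \ominus \Theta H^2$ be the associated model space, and let $S_{\Theta}$ be the compressed shift on $\mathcal{K}_{\Theta}$. For a bounded linear operator $A$ on $\mathcal{K}_{\Theta}$, the following are equivalent: (i) the sequence $\{S_{\Theta}^{*n} A S_{\Theta}^{n}\}_{n \geqslant 1}$ converges in operator norm; (ii) $S_{\Theta}^{*n} A S_{\Theta}^{n} \to 0$ in operator norm as $n \to \infty$; (iii) $A$ is a compact operator.
   Context: $H^2$ is the classical Hardy space of the open unit disk $\mathbb{D}$, regarded via boundary values as a closed subspace of $L^2 = L^2(\mathbb{T}, m)$, where $\mathbb{T}$ is the unit circle and $m$ is normalized Lebesgue measure on $\mathbb{T}$. An inner function $\Theta$ is a bounded analytic function on $\mathbb{D}$ whose radial boundary values are unimodular almost everywhere on $\mathbb{T}$. The model space is $\mathcal{K}_{\Theta} = H^2 \ominus \Theta H^2$, the orthogonal complement of $\Theta H^2$ in $H^2$. $S$ is the unilateral shift on $H^2$, $Sf = zf$; $P_{\Theta}$ is the orthogonal projection of $L^2$ onto $\mathcal{K}_{\Theta}$; and the compressed shift is $S_{\Theta} = P_{\Theta} S|_{\mathcal{K}_{\Theta}}$, a bounded operator on $\mathcal{K}_{\Theta}$ with adjoint $S_{\Theta}^{*}$. $S_{\Theta}^{*n}$ denotes $(S_{\Theta}^{*})^n$. *)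

theory Defs
  imports "HOL-Analysis.Analysis"
begin

section \<open>The space \<open>L\<^sup>2\<close> of the unit circle\<close>

text \<open>Normalized Lebesgue measure, as a measure whose underlying space is the circle itself:
  the values of a function off the circle are irrelevant.\<close>

definition circle_measure :: "complex measure" where
  "circle_measure =
     distr (uniform_measure lborel {0..2 * pi}) (restrict_space borel (sphere 0 1)) cis"

definition square_integrable :: "(complex \<Rightarrow> complex) \<Rightarrow> bool" where
  "square_integrable f \<longleftrightarrow>
     f \<in> borel_measurable circle_measure \<and> integrable circle_measure (\<lambda>z. (cmod (f z))\<^sup>2)"

definition L2_eq :: "(complex \<Rightarrow> complex) \<Rightarrow> (complex \<Rightarrow> complex) \<Rightarrow> bool" where
  "L2_eq f g \<longleftrightarrow>
     square_integrable f \<and> square_integrable g \<and> (AE z in circle_measure. f z = g z)"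

lemma space_circle_measure [simp]: "space circle_measure = sphere 0 1"
  by (simp add: circle_measure_def space_restrict_space)

lemma square_integrable_mult_cnj:
  assumes "square_integrable f" "square_integrable g"
  shows "integrable circle_measure (\<lambda>z. f z * cnj (g z))"
proof (rule Bochner_Integration.integrable_bound)
  show "integrable circle_measure (\<lambda>z. (cmod (f z))\<^sup>2 + (cmod (g z))\<^sup>2)"
    using assms by (simp add: square_integrable_def)
  have [measurable]: "f \<in> borel_measurable circle_measure" "g \<in> borel_measurable circle_measure"
    using assms by (simp_all add: square_integrable_def)
  show "(\<lambda>z. f z * cnj (g z)) \<in> borel_measurable circle_measure"
    by (intro borel_measurable_times borel_measurable_continuous_on[where f = cnj] continuous_intros)
       measurable
  have "a * b \<le> a\<^sup>2 + b\<^sup>2" for a b :: real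
    using sum_squares_bound[of a b] zero_le_power2[of a] zero_le_power2[of b] by linarith
  then show "AE z in circle_measure.
      norm (f z * cnj (g z)) \<le> norm ((cmod (f z))\<^sup>2 + (cmod (g z))\<^sup>2)"
    by (simp add: norm_mult)
qed

lemma square_integrable_add:
  assumes "square_integrable f" "square_integrable g"
  shows "square_integrable (\<lambda>z. f z + g z)"
  unfolding square_integrable_def
proof
  have [measurable]: "f \<in> borel_measurable circle_measure" "g \<in> borel_measurable circle_measure"
    using assms by (simp_all add: square_integrable_def)
  show "(\<lambda>z. f z + g z) \<in> borel_measurable circle_measure"
    by measurable
  show "integrable circle_measure (\<lambda>z. (cmod (f z + g z))\<^sup>2)"
  proof (rule Bochner_Integration.integrable_bound)
    show "integrable circle_measure (\<lambda>z. 2 * (cmod (f z))\<^sup>2 + 2 * (cmod (g z))\<^sup>2)"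
      using assms by (simp add: square_integrable_def)
    show "(\<lambda>z. (cmod (f z + g z))\<^sup>2) \<in> borel_measurable circle_measure"
      by measurable
    have "(cmod (a + b))\<^sup>2 \<le> 2 * (cmod a)\<^sup>2 + 2 * (cmod b)\<^sup>2" for a b
    proof -
      have "(cmod (a + b))\<^sup>2 \<le> (cmod a + cmod b)\<^sup>2"
        by (intro power_mono norm_triangle_ineq norm_ge_zero)
      also have "\<dots> \<le> 2 * (cmod a)\<^sup>2 + 2 * (cmod b)\<^sup>2"
        using sum_squares_bound[of "cmod a" "cmod b"] by (simp add: power2_sum)
      finally show ?thesis .
    qed
    then show "AE z in circle_measure.
        norm ((cmod (f z + g z))\<^sup>2) \<le> norm (2 * (cmod (f z))\<^sup>2 + 2 * (cmod (g z))\<^sup>2)"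
      by simp
  qed
qed

lemma square_integrable_cmult:
  assumes "square_integrable f"
  shows "square_integrable (\<lambda>z. c * f z)"
proof -
  have [measurable]: "f \<in> borel_measurable circle_measure"
    using assms by (simp add: square_integrable_def)
  have "(\<lambda>z. c * f z) \<in> borel_measurable circle_measure"
    by measurable
  then show ?thesis
    using assms by (simp add: square_integrable_def norm_mult power_mult_distrib)
qed

lemma square_integrable_zero: "square_integrable (\<lambda>_. 0)"
  by (simp add: square_integrable_def)

lemma square_integrable_shift:
  assumes "square_integrable f"
  shows "square_integrable (\<lambda>z. z * f z)"
  unfolding square_integrable_def
proof
  have [measurable]: "f \<in> borel_measurable circle_measure"
    using assms by (simp add: square_integrable_def)
  have [measurable]: "(\<lambda>z. z) \<in> borel_measurable circle_measure"
    unfolding circle_measure_def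
    by (simp add: borel_measurable_continuous_on_restrict)
  show "(\<lambda>z. z * f z) \<in> borel_measurable circle_measure"
    by measurable
  have "integrable circle_measure (\<lambda>z. (cmod (z * f z))\<^sup>2) \<longleftrightarrow>
        integrable circle_measure (\<lambda>z. (cmod (f z))\<^sup>2)"
    by (rule Bochner_Integration.integrable_cong) (auto simp: norm_mult)
  then show "integrable circle_measure (\<lambda>z. (cmod (z * f z))\<^sup>2)"
    using assms by (simp add: square_integrable_def)
qed

quotient_type L2_circle = "complex \<Rightarrow> complex" / partial: L2_eq
proof (rule part_equivpI)
  show "\<exists>f. L2_eq f f"
    using square_integrable_zero by (auto simp: L2_eq_def)
  show "symp L2_eq"
    by (rule sympI) (auto simp: L2_eq_def elim: eventually_mono)
  show "transp L2_eq"
    by (rule transpI) (auto simp: L2_eq_def elim: eventually_elim2)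
qed

text \<open>The class of a square-integrable function (unspecified for other arguments).\<close>

abbreviation L2_of :: "(complex \<Rightarrow> complex) \<Rightarrow> L2_circle" where
  "L2_of \<equiv> abs_L2_circle"

lift_definition cscale :: "complex \<Rightarrow> L2_circle \<Rightarrow> L2_circle" is "\<lambda>c f z. c * f z"
  by (auto simp: L2_eq_def square_integrable_cmult)

lift_definition cinner :: "L2_circle \<Rightarrow> L2_circle \<Rightarrow> complex" is
  "\<lambda>f g. \<integral>z. f z * cnj (g z) \<partial>circle_measure"
proof -
  fix f f' g g' assume "L2_eq f f'" "L2_eq g g'"
  then show "(\<integral>z. f z * cnj (g z) \<partial>circle_measure) = (\<integral>z. f' z * cnj (g' z) \<partial>circle_measure)"
    by (intro integral_cong_AE borel_measurable_integrable square_integrable_mult_cnj)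
       (auto simp: L2_eq_def)
qed

lift_definition shift :: "L2_circle \<Rightarrow> L2_circle" is "\<lambda>f z. z * f z"
  by (auto simp: L2_eq_def square_integrable_shift)

instantiation L2_circle :: real_vector
begin

lift_definition zero_L2_circle :: L2_circle is "\<lambda>_. 0"
  by (simp add: L2_eq_def square_integrable_zero)

lift_definition plus_L2_circle :: "L2_circle \<Rightarrow> L2_circle \<Rightarrow> L2_circle" is "\<lambda>f g z. f z + g z"
  by (auto simp: L2_eq_def square_integrable_add)

definition scaleR_L2_circle :: "real \<Rightarrow> L2_circle \<Rightarrow> L2_circle" where
  "scaleR_L2_circle r x = cscale (complex_of_real r) x"

definition uminus_L2_circle :: "L2_circle \<Rightarrow> L2_circle" where
  "uminus_L2_circle x = cscale (- 1) x"

definition minus_L2_circle :: "L2_circle \<Rightarrow> L2_circle \<Rightarrow> L2_circle" where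
  "minus_L2_circle x y = x + - y" for x y :: L2_circle

instance
proof
  fix x y z :: L2_circle and a b :: real
  show "x + y + z = x + (y + z)"
    by transfer (auto simp: L2_eq_def square_integrable_add algebra_simps)
  show "x + y = y + x"
    by transfer (auto simp: L2_eq_def square_integrable_add algebra_simps)
  show "0 + x = x"
    by transfer (auto simp: L2_eq_def)
  show "- x + x = 0"
    unfolding uminus_L2_circle_def
    by transfer (auto simp: L2_eq_def square_integrable_zero)
  show "x - y = x + - y"
    by (rule minus_L2_circle_def)
  show "a *\<^sub>R (x + y) = a *\<^sub>R x + a *\<^sub>R y"
    unfolding scaleR_L2_circle_def
    by transfer (auto simp: L2_eq_def square_integrable_add square_integrable_cmult distrib_left)
  show "(a + b) *\<^sub>R x = a *\<^sub>R x + b *\<^sub>R x"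
    unfolding scaleR_L2_circle_def
    by transfer (auto simp: L2_eq_def square_integrable_add square_integrable_cmult distrib_right)
  show "a *\<^sub>R b *\<^sub>R x = (a * b) *\<^sub>R x"
    unfolding scaleR_L2_circle_def
    by transfer (auto simp: L2_eq_def square_integrable_cmult mult.assoc)
  show "1 *\<^sub>R x = x"
    unfolding scaleR_L2_circle_def
    by transfer (auto simp: L2_eq_def)
qed

end

lemma cinner_commute: "cinner x y = cnj (cinner y x)"
proof transfer
  fix f g assume "L2_eq f f" "L2_eq g g"
  have "cnj (\<integral>z. g z * cnj (f z) \<partial>circle_measure) = (\<integral>z. cnj (g z * cnj (f z)) \<partial>circle_measure)"
    by (rule Bochner_Integration.integral_cnj[symmetric])
  then show "(\<integral>z. f z * cnj (g z) \<partial>circle_measure) = cnj (\<integral>z. g z * cnj (f z) \<partial>circle_measure)"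
    by (simp only: complex_cnj_mult complex_cnj_cnj mult.commute)
qed

lemma cinner_add_left: "cinner (x + y) w = cinner x w + cinner y w"
  by transfer (simp add: L2_eq_def square_integrable_mult_cnj distrib_right)

lemma cinner_cscale_left: "cinner (cscale c x) y = c * cinner x y"
  by transfer (simp add: mult.assoc)

text \<open>The library's class of inner product spaces is real, so \<open>L\<^sup>2\<close> enters it with the real part of
  its complex inner product; the norm and the topology are the usual ones.\<close>

instantiation L2_circle :: real_inner
begin

definition inner_L2_circle :: "L2_circle \<Rightarrow> L2_circle \<Rightarrow> real" where
  "inner_L2_circle x y = Re (cinner x y)"

definition norm_L2_circle :: "L2_circle \<Rightarrow> real" where
  "norm_L2_circle x = sqrt (Re (cinner x x))"

definition sgn_L2_circle :: "L2_circle \<Rightarrow> L2_circle" where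
  "sgn_L2_circle x = x /\<^sub>R norm x"

definition dist_L2_circle :: "L2_circle \<Rightarrow> L2_circle \<Rightarrow> real" where
  "dist_L2_circle x y = norm (x - y)"

definition uniformity_L2_circle :: "(L2_circle \<times> L2_circle) filter" where
  "uniformity_L2_circle = (INF e\<in>{0<..}. principal {(x, y). dist x y < e})"

definition open_L2_circle :: "L2_circle set \<Rightarrow> bool" where
  "open_L2_circle U \<longleftrightarrow> (\<forall>x\<in>U. eventually (\<lambda>(x', y). x' = x \<longrightarrow> y \<in> U) uniformity)"

instance
proof
  fix x y w :: L2_circle and r :: real and U :: "L2_circle set"
  show "dist x y = norm (x - y)"
    by (rule dist_L2_circle_def)
  show "sgn x = x /\<^sub>R norm x"
    by (rule sgn_L2_circle_def)
  show "(uniformity :: (L2_circle \<times> L2_circle) filter) =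
      (INF e\<in>{0<..}. principal {(x, y). dist x y < e})"
    by (rule uniformity_L2_circle_def)
  show "open U \<longleftrightarrow> (\<forall>x\<in>U. eventually (\<lambda>(x', y). x' = x \<longrightarrow> y \<in> U) uniformity)"
    by (rule open_L2_circle_def)
  show "x \<bullet> y = y \<bullet> x"
    unfolding inner_L2_circle_def by (subst cinner_commute) simp
  show "(x + y) \<bullet> w = x \<bullet> w + y \<bullet> w"
    by (simp add: inner_L2_circle_def cinner_add_left)
  show "(r *\<^sub>R x) \<bullet> y = r * (x \<bullet> y)"
    by (simp add: inner_L2_circle_def scaleR_L2_circle_def cinner_cscale_left)
  have self: "(\<integral>z. f z * cnj (f z) \<partial>circle_measure) =
      complex_of_real (\<integral>z. (cmod (f z))\<^sup>2 \<partial>circle_measure)" for f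
    unfolding complex_norm_square[symmetric] by (rule integral_complex_of_real)
  show "0 \<le> x \<bullet> x"
    unfolding inner_L2_circle_def by transfer (simp add: self)
  show "x \<bullet> x = 0 \<longleftrightarrow> x = 0"
    unfolding inner_L2_circle_def
  proof transfer
    fix f assume f: "L2_eq f f"
    then have "(\<integral>z. (cmod (f z))\<^sup>2 \<partial>circle_measure) = 0 \<longleftrightarrow> (AE z in circle_measure. (cmod (f z))\<^sup>2 = 0)"
      by (intro integral_nonneg_eq_0_iff_AE) (auto simp: L2_eq_def square_integrable_def)
    then show "Re (\<integral>z. f z * cnj (f z) \<partial>circle_measure) = 0 \<longleftrightarrow> L2_eq f (\<lambda>_. 0)"
      using f by (simp add: self L2_eq_def square_integrable_zero)
  qed
  show "norm x = sqrt (x \<bullet> x)"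
    by (simp add: norm_L2_circle_def inner_L2_circle_def)
qed

end


section \<open>Hardy space, inner functions, model spaces\<close>

text \<open>Functions analytic on the open unit disk with bounded square means; their values off the
  disk are irrelevant.\<close>

definition hardy_disk :: "(complex \<Rightarrow> complex) set" where
  "hardy_disk = {f. f holomorphic_on ball 0 1 \<and>
     bdd_above ((\<lambda>r. \<integral>z. (cmod (f (of_real r * z)))\<^sup>2 \<partial>circle_measure) ` {0..<1})}"

text \<open>Boundary values of a Hardy space function are its boundary function in \<open>L\<^sup>2\<close>, the limit in
  mean square of the dilates \<open>z \<mapsto> f (r z)\<close> as \<open>r\<close> increases to \<open>1\<close>
  (almost everywhere equal to its radial limit).\<close>

definition boundary_values :: "(complex \<Rightarrow> complex) set \<Rightarrow> L2_circle set" where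
  "boundary_values F =
     {g. \<exists>f\<in>F. ((\<lambda>r. L2_of (\<lambda>z. f (of_real r * z))) \<longlongrightarrow> g) (at_left (1::real))}"

definition H2 :: "L2_circle set" where
  "H2 = boundary_values hardy_disk"

definition inner_function :: "(complex \<Rightarrow> complex) \<Rightarrow> bool" where
  "inner_function \<Theta> \<longleftrightarrow>
     \<Theta> holomorphic_on ball 0 1 \<and> bounded (\<Theta> ` ball 0 1) \<and>
     (AE z in circle_measure.
        \<exists>l. ((\<lambda>r. \<Theta> (of_real r * z)) \<longlongrightarrow> l) (at_left (1::real)) \<and> cmod l = 1)"

definition mult_H2 :: "(complex \<Rightarrow> complex) \<Rightarrow> L2_circle set" where
  "mult_H2 \<Theta> = boundary_values ((\<lambda>f z. \<Theta> z * f z) ` hardy_disk)"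

definition model_space :: "(complex \<Rightarrow> complex) \<Rightarrow> L2_circle set" where
  "model_space \<Theta> = {g \<in> H2. \<forall>h\<in>mult_H2 \<Theta>. cinner g h = 0}"


section \<open>Operators on subspaces of \<open>L\<^sup>2\<close>\<close>

text \<open>An operator on a subspace \<open>K\<close> is a function on \<open>L2_circle\<close> of which only the values on \<open>K\<close>
  matter.\<close>

definition orth_proj :: "L2_circle set \<Rightarrow> L2_circle \<Rightarrow> L2_circle" where
  "orth_proj K f = (THE g. g \<in> K \<and> (\<forall>h\<in>K. cinner (f - g) h = 0))"

definition bounded_operator_on :: "L2_circle set \<Rightarrow> (L2_circle \<Rightarrow> L2_circle) \<Rightarrow> bool" where
  "bounded_operator_on K T \<longleftrightarrow>
     (\<forall>f\<in>K. T f \<in> K) \<and>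
     (\<forall>f\<in>K. \<forall>g\<in>K. T (f + g) = T f + T g) \<and>
     (\<forall>c. \<forall>f\<in>K. T (cscale c f) = cscale c (T f)) \<and>
     (\<exists>C. \<forall>f\<in>K. norm (T f) \<le> C * norm f)"

definition adjoint_on :: "L2_circle set \<Rightarrow> (L2_circle \<Rightarrow> L2_circle) \<Rightarrow> L2_circle \<Rightarrow> L2_circle" where
  "adjoint_on K T g = (THE h. h \<in> K \<and> (\<forall>f\<in>K. cinner (T f) g = cinner f h))"

definition op_norm_on :: "L2_circle set \<Rightarrow> (L2_circle \<Rightarrow> L2_circle) \<Rightarrow> real" where
  "op_norm_on K T = (SUP f\<in>{f\<in>K. norm f \<le> 1}. norm (T f))"

definition op_norm_tendsto_on ::
    "L2_circle set \<Rightarrow> (nat \<Rightarrow> L2_circle \<Rightarrow> L2_circle) \<Rightarrow> (L2_circle \<Rightarrow> L2_circle) \<Rightarrow> bool" where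
  "op_norm_tendsto_on K T B \<longleftrightarrow> (\<lambda>n. op_norm_on K (\<lambda>f. T n f - B f)) \<longlonglongrightarrow> 0"

definition compact_operator_on :: "L2_circle set \<Rightarrow> (L2_circle \<Rightarrow> L2_circle) \<Rightarrow> bool" where
  "compact_operator_on K T \<longleftrightarrow>
     bounded_operator_on K T \<and> compact (closure (T ` {f\<in>K. norm f \<le> 1}))"

definition compressed_shift :: "(complex \<Rightarrow> complex) \<Rightarrow> L2_circle \<Rightarrow> L2_circle" where
  "compressed_shift \<Theta> f = orth_proj (model_space \<Theta>) (shift f)"

definition compressed_shift_adj :: "(complex \<Rightarrow> complex) \<Rightarrow> L2_circle \<Rightarrow> L2_circle" where
  "compressed_shift_adj \<Theta> = adjoint_on (model_space \<Theta>) (compressed_shift \<Theta>)"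

end

(* Write T for the compressed shift and K for the model space. The adjoint of T is the backward shift
   on K, whose powers tend strongly to 0, and I - T T* has rank one.

   If A is compact, the powers of T* tend to 0 uniformly on the image of the unit ball.

   The powers of T also tend strongly to 0: since T^n P_K f = P_K(z^n f), this reduces to P_K(z^n) -> 0,
   which follows from the distance of z^n to Theta H^2. Hence |T*^n A T^n f| <= |A| |T^n f| -> 0, and
   the only possible limit of T*^n A T^n is 0.

   If T*^n A T^n -> 0 in norm, then Q A Q -> 0 in norm for Q = T^n T*^n, while I - Q has finite rank, so A is
   a norm limit of finite rank operators. *)

theory Submission
  imports Defs "HOL-Complex_Analysis.Complex_Analysis"
begin

section \<open>Lebesgue measure on the circle\<close>

text \<open>The unimodularity of \<open>\<Theta>\<close> serves one purpose,
  \<open>P (monomial n)\<close> -> 0: multiplication by the boundary function of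
  \<open>\<Theta>\<close> preserves moduli, and so the distance of z^n to
  \<open>mult_H2 \<Theta>\<close> is at most a tail of the Fourier series of
  \<open>\<Theta>\<close>. For \<open>\<Theta>\<close> = 0 the model space would be all of
  \<open>H2\<close> and the compressed shift an isometry. The other facts about \<open>T\<close>
  come from the backward shift mapping \<open>K\<close> into itself: this identifies the adjoint,
  and it gives \<open>T (P x) = P (shift x)\<close> on \<open>H2\<close>, so that powers of
  \<open>T\<close> are compressions of powers of the shift.

  Two features of the definitions shape the groundwork. \<open>H2\<close> and \<open>mult_H2\<close>
  consist of mean-square limits of dilates, which are hard to compute with; \<open>H2\<close> is
  therefore identified with the functions that are the sum of their Fourier series over nonnegative
  frequencies. And \<open>orth_proj\<close> and \<open>adjoint_on\<close> are definite descriptions,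
  which say nothing until existence and uniqueness are proved: the projection comes from
  completeness of the quotient space, the adjoint from an explicit formula.\<close>

lemma measurable_cis_circle:
  "cis \<in> uniform_measure lborel {0..2 * pi} \<rightarrow>\<^sub>M restrict_space borel (sphere 0 1)"
proof (rule measurable_restrict_space2)
  have "cis \<in> borel_measurable borel"
    by (intro borel_measurable_continuous_onI continuous_intros)
  then show "cis \<in> borel_measurable (uniform_measure lborel {0..2 * pi})"
    by (simp add: measurable_cong_sets[of "uniform_measure lborel {0..2 * pi}" borel borel borel])
qed simp

lemma emeasure_circle_measure: "emeasure circle_measure (sphere 0 1) = 1"
proof -
  have "sphere 0 1 \<in> sets (restrict_space borel (sphere (0::complex) 1))"
    using sets.top[of "restrict_space borel (sphere (0::complex) 1)"]
    by (simp add: space_restrict_space)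
  moreover have "cis -` sphere 0 1 = UNIV"
    by auto
  ultimately show ?thesis
    unfolding circle_measure_def
    by (simp add: emeasure_distr[OF measurable_cis_circle] ennreal_divide_self)
qed

lemma finite_measure_circle_measure: "finite_measure circle_measure"
  by (rule finite_measureI) (simp add: emeasure_circle_measure)

lemma measure_circle_measure [simp]: "measure circle_measure (sphere 0 1) = 1"
  by (simp add: measure_def emeasure_circle_measure)

lemma borel_measurable_circle_measure:
  fixes f :: "complex \<Rightarrow> 'a::topological_space"
  assumes "continuous_on (sphere 0 1) f"
  shows "f \<in> borel_measurable circle_measure"
  using borel_measurable_continuous_on_restrict[OF assms] by (simp add: circle_measure_def)

lemma square_integrable_bounded:
  assumes "f \<in> borel_measurable circle_measure"
    and "AE z in circle_measure. cmod (f z) \<le> M"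
  shows "square_integrable f"
  unfolding square_integrable_def
proof
  interpret finite_measure circle_measure by (rule finite_measure_circle_measure)
  have [measurable]: "f \<in> borel_measurable circle_measure" by fact
  show "integrable circle_measure (\<lambda>z. (cmod (f z))\<^sup>2)"
    using assms(2)
    by (intro integrable_const_bound[where B = "M\<^sup>2"]) (auto elim!: eventually_mono intro: power_mono)
qed fact

lemma square_integrable_continuous:
  assumes "continuous_on (sphere 0 1) f"
  shows "square_integrable f"
proof -
  have "compact (f ` sphere 0 1)"
    using assms by (intro compact_continuous_image) auto
  then obtain M where "\<forall>x\<in>f ` sphere 0 1. norm x \<le> M"
    using compact_imp_bounded bounded_iff by blast
  then show ?thesis
    using assms by (intro square_integrable_bounded[of _ M] borel_measurable_circle_measure) auto
qed

lemma integral_circle_measure: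
  fixes f :: "complex \<Rightarrow> 'a::euclidean_space"
  assumes "continuous_on (sphere 0 1) f"
  shows "(\<integral>z. f z \<partial>circle_measure) =
    (1 / (2 * pi)) *\<^sub>R (\<integral>t. indicator {0..2 * pi} t *\<^sub>R f (cis t) \<partial>lborel)"
proof -
  have *: "continuous_on UNIV (\<lambda>t. f (cis t))"
    by (rule continuous_on_compose2[OF assms]) (auto intro!: continuous_intros)
  then have [measurable]: "(\<lambda>t. f (cis t)) \<in> borel_measurable lborel"
    by (simp add: borel_measurable_continuous_onI)
  have "(\<integral>z. f z \<partial>circle_measure) = (\<integral>t. f (cis t) \<partial>uniform_measure lborel {0..2 * pi})"
    unfolding circle_measure_def
    using borel_measurable_continuous_on_restrict[OF assms]
    by (intro integral_distr measurable_cis_circle) simp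
  also have "uniform_measure lborel {0..2 * pi} =
      density lborel (\<lambda>t. ennreal (indicator {0..2 * pi} t / (2 * pi)))"
    unfolding uniform_measure_def
    by (intro arg_cong2[where f = density] refl ext)
       (auto simp: divide_ennreal ennreal_indicator[symmetric] split: split_indicator)
  also have "(\<integral>t. f (cis t) \<partial>\<dots>) = (\<integral>t. (indicator {0..2 * pi} t / (2 * pi)) *\<^sub>R f (cis t) \<partial>lborel)"
    by (rule integral_density) auto
  also have "\<dots> = (\<integral>t. (1 / (2 * pi)) *\<^sub>R (indicator {0..2 * pi} t *\<^sub>R f (cis t)) \<partial>lborel)"
    by simp
  finally show ?thesis
    by (simp only: integral_scaleR_right)
qed

text \<open>The antiderivative e^{int} / (in) takes the same value at both ends of the period.
  Orthogonality of the monomials rests on this.\<close>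

lemma integral_circle_measure_power:
  assumes "n > 0"
  shows "(\<integral>z. z ^ n \<partial>circle_measure) = 0"
proof -
  let ?F = "\<lambda>t. cis (real n * t) / (of_nat n * \<i>)"
  have "(?F has_vector_derivative cis t ^ n) (at t within {0..2 * pi})" for t
  proof -
    have "((\<lambda>w. exp (\<i> * of_nat n * w) / (of_nat n * \<i>)) has_field_derivative
        exp (\<i> * of_nat n * of_real t)) (at (of_real t))"
      using assms by (auto intro!: derivative_eq_intros)
    from has_vector_derivative_real_field[OF this] show ?thesis
      by (subst Complex.DeMoivre) (simp add: cis_conv_exp mult.assoc)
  qed
  then have "(\<integral>t. indicator {0..2 * pi} t *\<^sub>R cis t ^ n \<partial>lborel) = ?F (2 * pi) - ?F 0"
    by (intro has_bochner_integral_integral_eq[OF has_bochner_integral_FTC_Icc])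
       (auto intro!: continuous_intros)
  also have "cis (real n * (2 * pi)) = 1"
    by (metis cis_multiple_2pi Ints_of_nat mult.commute mult.left_commute)
  finally show ?thesis
    by (subst integral_circle_measure) (auto intro!: continuous_intros)
qed

section \<open>Complex Hilbert space structure\<close>

lemma L2_circle_cases [cases type: L2_circle]:
  obtains f where "square_integrable f" "x = L2_of f"
proof -
  have "\<exists>f. square_integrable f \<and> x = L2_of f"
    by (induction x rule: L2_circle.abs_induct) (auto simp: L2_eq_def)
  then show ?thesis using that by blast
qed

lemma L2_eq_refl: "square_integrable f \<Longrightarrow> L2_eq f f"
  by (simp add: L2_eq_def)

lemma L2_of_add:
  "square_integrable f \<Longrightarrow> square_integrable g \<Longrightarrow> L2_of f + L2_of g = L2_of (\<lambda>z. f z + g z)"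
  by (simp add: plus_L2_circle.abs_eq L2_eq_refl)

lemma cinner_L2_of:
  "square_integrable f \<Longrightarrow> square_integrable g \<Longrightarrow>
    cinner (L2_of f) (L2_of g) = (\<integral>z. f z * cnj (g z) \<partial>circle_measure)"
  by (simp add: cinner.abs_eq L2_eq_refl)

lemma cscale_L2_of: "square_integrable f \<Longrightarrow> cscale c (L2_of f) = L2_of (\<lambda>z. c * f z)"
  by (simp add: cscale.abs_eq L2_eq_refl)

lemma shift_L2_of: "square_integrable f \<Longrightarrow> shift (L2_of f) = L2_of (\<lambda>z. z * f z)"
  by (simp add: shift.abs_eq L2_eq_refl)

lemma norm_L2_of:
  assumes "square_integrable f"
  shows "(norm (L2_of f))\<^sup>2 = (\<integral>z. (cmod (f z))\<^sup>2 \<partial>circle_measure)"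
proof -
  have "(\<integral>z. f z * cnj (f z) \<partial>circle_measure) =
      complex_of_real (\<integral>z. (cmod (f z))\<^sup>2 \<partial>circle_measure)"
    unfolding complex_norm_square[symmetric] by (rule integral_complex_of_real)
  then have "Re (cinner (L2_of f) (L2_of f)) = (\<integral>z. (cmod (f z))\<^sup>2 \<partial>circle_measure)"
    using assms by (simp add: cinner_L2_of)
  then show ?thesis
    by (simp add: norm_L2_circle_def)
qed

lemma square_integrable_diff:
  assumes "square_integrable f" "square_integrable g"
  shows "square_integrable (\<lambda>z. f z - g z)"
  using square_integrable_add[OF assms(1) square_integrable_cmult[OF assms(2), of "-1"]] by simp

lemma L2_of_diff:
  assumes "square_integrable f" "square_integrable g"
  shows "L2_of f - L2_of g = L2_of (\<lambda>z. f z - g z)"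
  unfolding minus_L2_circle_def uminus_L2_circle_def
  using assms square_integrable_cmult[OF assms(2), of "-1"]
  by (simp add: cscale_L2_of L2_of_add)

lemma cscale_add_right: "cscale c (x + y) = cscale c x + cscale c y"
  by transfer (auto simp: L2_eq_def square_integrable_add square_integrable_cmult distrib_left)

lemma cscale_add_left: "cscale (c + d) x = cscale c x + cscale d x"
  by transfer (auto simp: L2_eq_def square_integrable_add square_integrable_cmult distrib_right)

lemma cscale_cscale [simp]: "cscale c (cscale d x) = cscale (c * d) x"
  by transfer (auto simp: L2_eq_def square_integrable_cmult mult.assoc)

lemma cscale_one [simp]: "cscale 1 x = x"
  by transfer (auto simp: L2_eq_def)

lemma cscale_zero [simp]: "cscale 0 x = 0"
  by transfer (auto simp: L2_eq_def square_integrable_zero)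

lemma cscale_zero_right [simp]: "cscale c 0 = 0"
  by transfer (auto simp: L2_eq_def square_integrable_zero)

lemma uminus_eq_cscale: "- x = cscale (- 1) x"
  by (rule uminus_L2_circle_def)

lemma cscale_minus_right: "cscale c (- x) = - cscale c x"
  by (simp add: uminus_eq_cscale)

lemma cscale_diff_right: "cscale c (x - y) = cscale c x - cscale c y"
  by (simp only: diff_conv_add_uminus cscale_add_right cscale_minus_right)

lemma cscale_sum: "cscale c (\<Sum>i\<in>I. f i) = (\<Sum>i\<in>I. cscale c (f i))"
  by (induction I rule: infinite_finite_induct) (simp_all add: cscale_add_right)

lemma cinner_add_right: "cinner x (y + w) = cinner x y + cinner x w"
  by (metis cinner_commute cinner_add_left complex_cnj_add)

lemma cinner_cscale_right: "cinner x (cscale c y) = cnj c * cinner x y"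
  by (metis cinner_commute cinner_cscale_left complex_cnj_mult)

lemma cinner_minus_left: "cinner (- x) y = - cinner x y"
  by (simp add: uminus_eq_cscale cinner_cscale_left)

lemma cinner_minus_right: "cinner x (- y) = - cinner x y"
  by (simp add: uminus_eq_cscale cinner_cscale_right)

lemma cinner_diff_left: "cinner (x - y) w = cinner x w - cinner y w"
  by (simp only: diff_conv_add_uminus cinner_add_left cinner_minus_left)

lemma cinner_diff_right: "cinner x (y - w) = cinner x y - cinner x w"
  by (simp only: diff_conv_add_uminus cinner_add_right cinner_minus_right)

lemma cinner_zero_left [simp]: "cinner 0 x = 0"
  using cinner_cscale_left[of 0 x x] by simp

lemma cinner_zero_right [simp]: "cinner x 0 = 0"
  using cinner_cscale_right[of x 0 x] by simp

lemma cinner_sum_left: "cinner (\<Sum>i\<in>I. f i) x = (\<Sum>i\<in>I. cinner (f i) x)"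
  by (induction I rule: infinite_finite_induct) (simp_all add: cinner_add_left)

lemma cinner_sum_right: "cinner x (\<Sum>i\<in>I. f i) = (\<Sum>i\<in>I. cinner x (f i))"
  by (induction I rule: infinite_finite_induct) (simp_all add: cinner_add_right)

lemmas cinner_simps = cinner_add_left cinner_add_right cinner_diff_left cinner_diff_right
  cinner_cscale_left cinner_cscale_right cinner_sum_left cinner_sum_right

lemma cinner_self: "cinner x x = complex_of_real ((norm x)\<^sup>2)"
proof (rule complex_eqI)
  show "Re (cinner x x) = Re (complex_of_real ((norm x)\<^sup>2))"
    using inner_ge_zero[of x] by (simp add: norm_L2_circle_def inner_L2_circle_def)
  have "Im (cinner x x) = - Im (cinner x x)"
    by (subst cinner_commute) simp
  then show "Im (cinner x x) = Im (complex_of_real ((norm x)\<^sup>2))"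
    by simp
qed

lemma norm_cscale [simp]: "norm (cscale c x) = cmod c * norm x"
proof -
  have "complex_of_real ((norm (cscale c x))\<^sup>2) = (c * cnj c) * cinner x x"
    unfolding cinner_self[symmetric] by (simp add: cinner_simps)
  also have "\<dots> = complex_of_real ((cmod c * norm x)\<^sup>2)"
    by (simp add: cinner_self complex_norm_square[symmetric] power_mult_distrib)
  finally have "complex_of_real ((norm (cscale c x))\<^sup>2) = complex_of_real ((cmod c * norm x)\<^sup>2)" .
  then have "(norm (cscale c x))\<^sup>2 = (cmod c * norm x)\<^sup>2"
    by (simp only: of_real_eq_iff)
  then show ?thesis
    by (simp add: power2_eq_iff_nonneg)
qed

lemma norm_cinner_le: "cmod (cinner x y) \<le> norm x * norm y"
proof (cases "cinner x y = 0")
  case False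
  \<comment> \<open>The real Cauchy-Schwarz inequality bounds only the real part of
    \<open>cinner\<close>. Rotating \<open>x\<close> by the unimodular \<open>c\<close> makes the
    product real and equal to its modulus.\<close>
  define c where "c = cnj (cinner x y) / cmod (cinner x y)"
  have c: "cmod c = 1"
    using False by (simp add: c_def norm_divide)
  have "c * cinner x y = complex_of_real (cmod (cinner x y))"
    using False complex_norm_square[of "cinner x y"]
    by (simp add: c_def field_simps power2_eq_square)
  then have "cmod (cinner x y) = inner (cscale c x) y"
    by (simp add: inner_L2_circle_def cinner_simps)
  also have "\<dots> \<le> norm (cscale c x) * norm y"
    by (rule norm_cauchy_schwarz)
  finally show ?thesis
    by (simp add: c)
qed simp

lemma bounded_linear_cscale: "bounded_linear (cscale c)"
  by (rule bounded_linear_intro[where K = "cmod c"])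
     (simp_all add: cscale_add_right scaleR_L2_circle_def mult.commute)

lemma bounded_linear_cscale_left: "bounded_linear (\<lambda>c. cscale c x)"
  by (rule bounded_linear_intro[where K = "norm x"])
     (simp_all add: cscale_add_left scaleR_L2_circle_def scaleR_conv_of_real)

lemma bounded_linear_cinner_left: "bounded_linear (\<lambda>x. cinner x y)"
  by (rule bounded_linear_intro[where K = "norm y"])
     (simp_all add: cinner_simps scaleR_L2_circle_def scaleR_conv_of_real norm_cinner_le)

lemma bounded_linear_cinner_right: "bounded_linear (\<lambda>y. cinner x y)"
  by (rule bounded_linear_intro[where K = "norm x"])
     (simp_all add: cinner_simps scaleR_L2_circle_def scaleR_conv_of_real norm_cinner_le mult.commute[of _ "norm x"])

lemmas tendsto_cinner_left [tendsto_intros] = bounded_linear.tendsto[OF bounded_linear_cinner_left]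
lemmas tendsto_cinner_right [tendsto_intros] = bounded_linear.tendsto[OF bounded_linear_cinner_right]
lemmas tendsto_cscale [tendsto_intros] = bounded_linear.tendsto[OF bounded_linear_cscale]
lemmas tendsto_cscale_left [tendsto_intros] = bounded_linear.tendsto[OF bounded_linear_cscale_left]

lemma norm_add_orthogonal:
  assumes "cinner x y = 0"
  shows "(norm (x + y))\<^sup>2 = (norm x)\<^sup>2 + (norm y)\<^sup>2"
proof -
  have "inner x y = 0" using assms by (simp add: inner_L2_circle_def)
  then show ?thesis
    by (simp add: power2_norm_eq_inner inner_add inner_commute)
qed

section \<open>Multiplication by the coordinate and by its conjugate\<close>

lemma square_integrable_cnj_shift:
  assumes "square_integrable f"
  shows "square_integrable (\<lambda>z. cnj z * f z)"
  unfolding square_integrable_def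
proof
  have [measurable]: "f \<in> borel_measurable circle_measure"
    using assms by (simp add: square_integrable_def)
  have [measurable]: "cnj \<in> borel_measurable circle_measure"
    by (intro borel_measurable_circle_measure continuous_intros)
  show "(\<lambda>z. cnj z * f z) \<in> borel_measurable circle_measure"
    by measurable
  have "integrable circle_measure (\<lambda>z. (cmod (cnj z * f z))\<^sup>2) \<longleftrightarrow>
        integrable circle_measure (\<lambda>z. (cmod (f z))\<^sup>2)"
    by (rule Bochner_Integration.integrable_cong) (auto simp: norm_mult)
  then show "integrable circle_measure (\<lambda>z. (cmod (cnj z * f z))\<^sup>2)"
    using assms by (simp add: square_integrable_def)
qed

text \<open>On all of L^2 the shift is unitary, and this is its inverse and its adjoint at
  once.\<close>

lift_definition cshift :: "L2_circle \<Rightarrow> L2_circle" is "\<lambda>f z. cnj z * f z"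
  by (auto simp: L2_eq_def square_integrable_cnj_shift)

lemma cinner_shift_left: "cinner (shift x) y = cinner x (cshift y)"
  by transfer (simp add: mult_ac)

lemma cinner_cshift_left: "cinner (cshift x) y = cinner x (shift y)"
  by (metis cinner_commute cinner_shift_left)

lemma shift_cshift [simp]: "shift (cshift x) = x"
proof transfer
  fix f assume f: "L2_eq f f"
  have "z * (cnj z * f z) = f z" if "cmod z = 1" for z
    using that complex_norm_square[of z] by (simp add: mult.assoc[symmetric])
  with f show "L2_eq (\<lambda>z. z * (cnj z * f z)) f"
    unfolding L2_eq_def
    by (intro conjI square_integrable_shift square_integrable_cnj_shift AE_I2) auto
qed

lemma cshift_shift [simp]: "cshift (shift x) = x"
proof transfer
  fix f assume f: "L2_eq f f"
  have "cnj z * (z * f z) = f z" if "cmod z = 1" for z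
    using that complex_norm_square[of z] by (simp add: mult.assoc[symmetric] mult.commute[of "cnj z"])
  with f show "L2_eq (\<lambda>z. cnj z * (z * f z)) f"
    unfolding L2_eq_def
    by (intro conjI square_integrable_shift square_integrable_cnj_shift AE_I2) auto
qed

lemma shift_add: "shift (x + y) = shift x + shift y"
  by transfer (auto simp: L2_eq_def square_integrable_add square_integrable_shift distrib_left)

lemma shift_cscale: "shift (cscale c x) = cscale c (shift x)"
  by transfer (auto simp: L2_eq_def square_integrable_cmult square_integrable_shift mult_ac)

lemma cshift_add: "cshift (x + y) = cshift x + cshift y"
  by (metis cshift_shift shift_add shift_cshift)

lemma cshift_cscale: "cshift (cscale c x) = cscale c (cshift x)"
  by (metis cshift_shift shift_cscale shift_cshift)

lemma norm_shift [simp]: "norm (shift x) = norm x"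
  by (simp add: norm_L2_circle_def cinner_shift_left)

lemma norm_cshift [simp]: "norm (cshift x) = norm x"
  by (metis norm_shift shift_cshift)

lemma bounded_linear_shift: "bounded_linear shift"
  by (rule bounded_linear_intro[where K = 1]) (simp_all add: shift_add shift_cscale scaleR_L2_circle_def)

lemma bounded_linear_cshift: "bounded_linear cshift"
  by (rule bounded_linear_intro[where K = 1]) (simp_all add: cshift_add cshift_cscale scaleR_L2_circle_def)

lemmas tendsto_shift [tendsto_intros] = bounded_linear.tendsto[OF bounded_linear_shift]
lemmas tendsto_cshift [tendsto_intros] = bounded_linear.tendsto[OF bounded_linear_cshift]

section \<open>Completeness and orthogonal projections\<close>

lemma nn_integral_norm_L2_of:
  assumes "square_integrable f"
  shows "(\<integral>\<^sup>+z. ennreal ((cmod (f z))\<^sup>2) \<partial>circle_measure) = ennreal ((norm (L2_of f))\<^sup>2)"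
  using assms by (simp add: norm_L2_of nn_integral_eq_integral square_integrable_def)

text \<open>Cauchy-Schwarz against the constant 1, which has norm 1 because the total mass is
  1.\<close>

lemma integral_norm_le_norm_L2_of:
  assumes "square_integrable f"
  shows "integrable circle_measure (\<lambda>z. cmod (f z))"
    and "(\<integral>z. cmod (f z) \<partial>circle_measure) \<le> norm (L2_of f)"
proof -
  have [measurable]: "f \<in> borel_measurable circle_measure"
    and "integrable circle_measure (\<lambda>z. (cmod (f z))\<^sup>2)"
    using assms by (simp_all add: square_integrable_def)
  then have absf: "square_integrable (\<lambda>z. complex_of_real (cmod (f z)))"
    by (simp add: square_integrable_def)
  have one: "square_integrable (\<lambda>_. 1)"
    by (intro square_integrable_continuous continuous_intros)
  have "integrable circle_measure (\<lambda>z. complex_of_real (cmod (f z)))"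
    using square_integrable_mult_cnj[OF absf one] by simp
  from integrable_norm[OF this] show "integrable circle_measure (\<lambda>z. cmod (f z))"
    by simp
  have "(norm (L2_of (\<lambda>z. complex_of_real (cmod (f z)))))\<^sup>2 = (norm (L2_of f))\<^sup>2"
    "(norm (L2_of (\<lambda>_. 1)))\<^sup>2 = 1\<^sup>2"
    using norm_L2_of[OF absf] norm_L2_of[OF assms] norm_L2_of[OF one] by simp_all
  then have norms: "norm (L2_of (\<lambda>z. complex_of_real (cmod (f z)))) = norm (L2_of f)"
    "norm (L2_of (\<lambda>_. 1)) = 1"
    using power2_eq_iff_nonneg norm_ge_zero zero_le_one by blast+
  have "complex_of_real (\<integral>z. cmod (f z) \<partial>circle_measure) =
      cinner (L2_of (\<lambda>z. complex_of_real (cmod (f z)))) (L2_of (\<lambda>_. 1))"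
    using absf one by (simp add: cinner_L2_of)
  then have "cmod (complex_of_real (\<integral>z. cmod (f z) \<partial>circle_measure)) \<le> norm (L2_of f)"
    using norm_cinner_le[of "L2_of (\<lambda>z. complex_of_real (cmod (f z)))" "L2_of (\<lambda>_. 1)"] norms
    by simp
  then show "(\<integral>z. cmod (f z) \<partial>circle_measure) \<le> norm (L2_of f)"
    by simp
qed

text \<open>Sum and integral of nonnegative functions may be exchanged, so the sum of the moduli has
  finite integral and is finite almost everywhere.\<close>

lemma AE_summable_norm:
  assumes "\<And>n. square_integrable (D n)" and "summable (\<lambda>n. norm (L2_of (D n)))"
  shows "AE z in circle_measure. summable (\<lambda>n. cmod (D n z))"
proof -
  have [measurable]: "D n \<in> borel_measurable circle_measure" for n
    using assms(1) by (simp add: square_integrable_def)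
  have "(\<integral>\<^sup>+z. (\<Sum>n. ennreal (cmod (D n z))) \<partial>circle_measure) =
      (\<Sum>n. \<integral>\<^sup>+z. ennreal (cmod (D n z)) \<partial>circle_measure)"
    by (rule nn_integral_suminf) measurable
  also have "\<dots> = (\<Sum>n. ennreal (\<integral>z. cmod (D n z) \<partial>circle_measure))"
    using integral_norm_le_norm_L2_of(1)[OF assms(1)] by (simp add: nn_integral_eq_integral)
  also have "\<dots> \<le> (\<Sum>n. ennreal (norm (L2_of (D n))))"
    using integral_norm_le_norm_L2_of(2)[OF assms(1)] by (intro suminf_le summableI) (auto intro: ennreal_leI)
  also have "\<dots> < \<infinity>"
    by (subst suminf_ennreal2[OF norm_ge_zero assms(2)]) simp
  finally have "AE z in circle_measure. (\<Sum>n. ennreal (cmod (D n z))) \<noteq> \<infinity>"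
    by (intro nn_integral_PInf_AE less_imp_neq) measurable
  then show ?thesis
  proof eventually_elim
    case (elim z)
    then show ?case
      by (intro summable_suminf_not_top) (simp_all only: norm_ge_zero infinity_ennreal_def not_False_eq_True)
  qed
qed

text \<open>Riesz--Fischer: a rapidly converging subsequence converges almost everywhere, and by Fatou
  its pointwise limit is the limit in mean square.\<close>

lemma complete_L2_circle: "complete (UNIV :: L2_circle set)"
  unfolding complete_def
proof (intro allI impI)
  fix X :: "nat \<Rightarrow> L2_circle" assume "(\<forall>n. X n \<in> UNIV) \<and> Cauchy X"
  then have X: "Cauchy X" by simp
  have "\<exists>f. square_integrable f \<and> X n = L2_of f" for n
    by (cases "X n") auto
  then obtain F where F: "\<And>n. square_integrable (F n)" "\<And>n. X n = L2_of (F n)"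
    by metis
  have [measurable]: "F n \<in> borel_measurable circle_measure" for n
    using F by (simp add: square_integrable_def)
  have "\<exists>M. \<forall>m\<ge>M. \<forall>n\<ge>M. norm (X m - X n) < (1 / 2) ^ j" for j
    by (rule CauchyD[OF X]) simp
  then obtain M where M: "\<And>j m n. M j \<le> m \<Longrightarrow> M j \<le> n \<Longrightarrow> norm (X m - X n) < (1 / 2) ^ j"
    by metis
  \<comment> \<open>Adding up all earlier thresholds makes \<open>r\<close> increasing and at least
    \<open>M j\<close> at once, so consecutive terms of the subsequence differ by less than
    2^-j.\<close>
  define r where "r j = j + (\<Sum>i\<le>j. M i)" for j
  have r: "j \<le> r j" "M j \<le> r j" "r j \<le> r (Suc j)" for j
    using member_le_sum[of j "{..j}" M] by (auto simp: r_def)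
  define D where "D j z = F (r (Suc j)) z - F (r j) z" for j z
  have D: "square_integrable (D j)" "L2_of (D j) = X (r (Suc j)) - X (r j)" for j
    using square_integrable_diff[OF F(1) F(1)] L2_of_diff[OF F(1) F(1)]
    by (simp_all add: D_def[abs_def] F(2))
  have "summable (\<lambda>j. norm (L2_of (D j)))"
  proof (rule summable_comparison_test')
    show "summable (\<lambda>j. (1 / 2 :: real) ^ j)"
      by (rule summable_geometric) simp
    show "norm (norm (L2_of (D j))) \<le> (1 / 2) ^ j" if "j \<ge> 0" for j
      using M[of j "r (Suc j)" "r j"] r(2,3)[of j] by (simp add: D)
  qed
  with D(1) have "AE z in circle_measure. summable (\<lambda>j. cmod (D j z))"
    by (rule AE_summable_norm)
  then have conv: "AE z in circle_measure. convergent (\<lambda>j. F (r j) z)"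
  proof eventually_elim
    case (elim z)
    then have "convergent (\<lambda>n. F (r 0) z + (\<Sum>j<n. D j z))"
      by (intro convergent_add convergent_const)
         (simp add: summable_norm_cancel summable_iff_convergent[symmetric])
    moreover have "F (r 0) z + (\<Sum>j<n. D j z) = F (r n) z" for n
      using sum_lessThan_telescope[of "\<lambda>j. F (r j) z" n] by (simp add: D_def)
    ultimately show ?case by simp
  qed
  define f where "f z = lim (\<lambda>j. F (r j) z)" for z
  have [measurable]: "f \<in> borel_measurable circle_measure"
    unfolding f_def[abs_def] by (rule borel_measurable_lim_metric) simp
  have lim: "AE z in circle_measure. (\<lambda>j. F (r j) z) \<longlonglongrightarrow> f z"
    using conv by eventually_elim (simp add: f_def convergent_LIMSEQ_iff)
  \<comment> \<open>The bound is kept as a nonnegative integral because square integrability of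
    \<open>f\<close> is still open. It is used twice: to prove that integrability, and then for
    convergence of the whole sequence rather than of the subsequence.\<close>
  have fatou: "(\<integral>\<^sup>+z. ennreal ((cmod (f z - F n z))\<^sup>2) \<partial>circle_measure) \<le> ennreal (e\<^sup>2)"
    if e: "\<And>m. m \<ge> N \<Longrightarrow> norm (X m - X n) \<le> e" for n N e
  proof -
    have "(\<integral>\<^sup>+z. ennreal ((cmod (f z - F n z))\<^sup>2) \<partial>circle_measure) =
        (\<integral>\<^sup>+z. liminf (\<lambda>j. ennreal ((cmod (F (r j) z - F n z))\<^sup>2)) \<partial>circle_measure)"
    proof (intro nn_integral_cong_AE)
      show "AE z in circle_measure. ennreal ((cmod (f z - F n z))\<^sup>2) =
          liminf (\<lambda>j. ennreal ((cmod (F (r j) z - F n z))\<^sup>2))"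
        using lim
      proof eventually_elim
        case (elim z)
        then have "(\<lambda>j. ennreal ((cmod (F (r j) z - F n z))\<^sup>2)) \<longlonglongrightarrow> ennreal ((cmod (f z - F n z))\<^sup>2)"
          by (intro tendsto_intros)
        then show ?case
          by (intro lim_imp_Liminf[symmetric]) auto
      qed
    qed
    also have "\<dots> \<le> liminf (\<lambda>j. \<integral>\<^sup>+z. ennreal ((cmod (F (r j) z - F n z))\<^sup>2) \<partial>circle_measure)"
      by (rule nn_integral_liminf) measurable
    also have "\<dots> = liminf (\<lambda>j. ennreal ((norm (X (r j) - X n))\<^sup>2))"
      by (simp add: nn_integral_norm_L2_of[OF square_integrable_diff[OF F(1) F(1)]]
          L2_of_diff[OF F(1) F(1)] F(2))
    also have "\<dots> \<le> liminf (\<lambda>j. ennreal (e\<^sup>2))"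
    proof (rule Liminf_mono)
      have "norm (X (r j) - X n) \<le> e" if "j \<ge> N" for j
        using e r(1)[of j] that by simp
      then show "\<forall>\<^sub>F j in sequentially. ennreal ((norm (X (r j) - X n))\<^sup>2) \<le> ennreal (e\<^sup>2)"
        unfolding eventually_sequentially by (intro exI[of _ N]) (auto intro!: ennreal_leI power_mono)
    qed
    finally show ?thesis
      by (simp add: Liminf_const)
  qed
  have diff: "square_integrable (\<lambda>z. f z - F n z)" if "\<And>m. m \<ge> N \<Longrightarrow> norm (X m - X n) \<le> e" for n N e
    unfolding square_integrable_def
  proof (intro conjI integrableI_bounded)
    have "(\<integral>\<^sup>+z. ennreal (norm ((cmod (f z - F n z))\<^sup>2)) \<partial>circle_measure) \<le> ennreal (e\<^sup>2)"
      using fatou[OF that] by simp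
    also have "\<dots> < \<infinity>" by simp
    finally show "(\<integral>\<^sup>+z. ennreal (norm ((cmod (f z - F n z))\<^sup>2)) \<partial>circle_measure) < \<infinity>" .
  qed measurable
  obtain N0 where "\<forall>m\<ge>N0. \<forall>n\<ge>N0. norm (X m - X n) < 1"
    using CauchyD[OF X, of 1] by auto
  \<comment> \<open>Fatou reaches only the differences \<open>f z - F n z\<close>; one of the given
    functions is added back.\<close>
  then have "square_integrable (\<lambda>z. (f z - F N0 z) + F N0 z)"
    by (intro square_integrable_add diff[of N0 N0 1] F(1)) (auto intro: less_imp_le)
  then have f: "square_integrable f" by simp
  have "X \<longlonglongrightarrow> L2_of f"
  proof (rule LIMSEQ_I)
    fix e :: real assume "e > 0"
    then obtain N where N: "\<forall>m\<ge>N. \<forall>n\<ge>N. norm (X m - X n) < e / 2"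
      using CauchyD[OF X, of "e / 2"] by auto
    have "norm (X n - L2_of f) < e" if "n \<ge> N" for n
    proof -
      have "norm (X m - X n) \<le> e / 2" if "m \<ge> N" for m
        using N that \<open>n \<ge> N\<close> by (simp add: less_imp_le)
      then have "ennreal ((norm (X n - L2_of f))\<^sup>2) \<le> ennreal ((e / 2)\<^sup>2)"
        using fatou[of N n "e / 2"] nn_integral_norm_L2_of[OF square_integrable_diff[OF f F(1)], of n]
        by (simp only: L2_of_diff[OF f F(1), symmetric] F(2)[symmetric] norm_minus_commute)
      then have "(norm (X n - L2_of f))\<^sup>2 \<le> (e / 2)\<^sup>2"
        by (subst (asm) ennreal_le_iff) simp_all
      then have "norm (X n - L2_of f) \<le> e / 2"
        by (rule power2_le_imp_le) (use \<open>e > 0\<close> in simp)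
      then show ?thesis
        using \<open>e > 0\<close> by linarith
    qed
    then show "\<exists>N. \<forall>n\<ge>N. norm (X n - L2_of f) < e" by blast
  qed
  then show "\<exists>l\<in>UNIV. X \<longlonglongrightarrow> l" by blast
qed

section \<open>Orthogonal projections\<close>

text \<open>The projection is the nearest point of \<open>S\<close>: the parallelogram law makes a
  minimizing sequence Cauchy, and a nonzero component of \<open>x - p\<close> along some
  \<open>h\<close> in \<open>S\<close> would allow a still nearer point.\<close>

lemma orthogonal_projection_exists:
  fixes S :: "'a::real_inner set"
  assumes "complete S" "subspace S"
  shows "\<exists>y\<in>S. \<forall>h\<in>S. inner (x - y) h = 0"
proof -
  define Q where "Q = (\<lambda>y. (norm (x - y))\<^sup>2) ` S"
  define d where "d = Inf Q"
  have ne: "Q \<noteq> {}" and bdd: "bdd_below Q"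
    using subspace_0[OF assms(2)] by (auto simp: Q_def intro!: bdd_belowI[of _ 0])
  have lower: "d \<le> (norm (x - y))\<^sup>2" if "y \<in> S" for y
    unfolding d_def using that by (intro cInf_lower bdd) (auto simp: Q_def)
  have "\<exists>y\<in>S. (norm (x - y))\<^sup>2 < d + 1 / real (Suc n)" for n
    using cInf_lessD[OF ne, of "d + 1 / real (Suc n)"] by (auto simp: Q_def d_def)
  then obtain y where y: "\<And>n. y n \<in> S" "\<And>n. (norm (x - y n))\<^sup>2 < d + 1 / real (Suc n)"
    by metis
  \<comment> \<open>Parallelogram law for \<open>x - y m\<close> and \<open>x - y n\<close>; the
    midpoint of \<open>y m\<close> and \<open>y n\<close> lies in \<open>S\<close>, so its squared
    distance to \<open>x\<close> is at least \<open>d\<close>.\<close>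
  have para: "(norm (y m - y n))\<^sup>2 \<le> 2 / real (Suc m) + 2 / real (Suc n)" for m n
  proof -
    have "(1 / 2) *\<^sub>R (y m + y n) \<in> S"
      using assms(2) y(1) by (intro subspace_scale subspace_add)
    from lower[OF this] have "4 * d \<le> (norm (2 *\<^sub>R (x - (1 / 2) *\<^sub>R (y m + y n))))\<^sup>2"
      by (simp add: power_mult_distrib)
    also have "2 *\<^sub>R (x - (1 / 2) *\<^sub>R (y m + y n)) = (x - y m) + (x - y n)"
      by (simp add: algebra_simps scaleR_2)
    finally have "4 * d \<le> (norm ((x - y m) + (x - y n)))\<^sup>2" .
    moreover have "(norm ((x - y m) + (x - y n)))\<^sup>2 + (norm (y m - y n))\<^sup>2 =
        2 * (norm (x - y m))\<^sup>2 + 2 * (norm (x - y n))\<^sup>2"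
      unfolding power2_norm_eq_inner by (simp add: inner_simps inner_commute algebra_simps)
    ultimately show ?thesis using y(2)[of m] y(2)[of n] by simp
  qed
  have "Cauchy y"
  proof (rule CauchyI)
    fix e :: real assume "e > 0"
    then obtain N where N: "4 / real (Suc N) < e\<^sup>2"
      using reals_Archimedean[of "e\<^sup>2 / 4"] by (auto simp: field_simps)
    have "norm (y m - y n) < e" if "m \<ge> N" "n \<ge> N" for m n
    proof -
      have "2 / real (Suc m) \<le> 2 / real (Suc N)" "2 / real (Suc n) \<le> 2 / real (Suc N)"
        using that by (auto intro!: divide_left_mono)
      with para[of m n] N have "(norm (y m - y n))\<^sup>2 < e\<^sup>2"
        by simp
      then show ?thesis
        using \<open>e > 0\<close> by (simp add: power_less_imp_less_base)
    qed
    then show "\<exists>M. \<forall>m\<ge>M. \<forall>n\<ge>M. norm (y m - y n) < e" by blast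
  qed
  then obtain p where p: "p \<in> S" "y \<longlonglongrightarrow> p"
    using assms(1) y(1) unfolding complete_def by blast
  have "(norm (x - p))\<^sup>2 \<le> d + 0"
  proof (rule LIMSEQ_le)
    show "(\<lambda>n. (norm (x - y n))\<^sup>2) \<longlonglongrightarrow> (norm (x - p))\<^sup>2"
      by (intro tendsto_intros p)
    show "(\<lambda>n. d + 1 / real (Suc n)) \<longlonglongrightarrow> d + 0"
      by (intro tendsto_add tendsto_const LIMSEQ_Suc[OF lim_1_over_n])
    show "\<exists>N. \<forall>n\<ge>N. (norm (x - y n))\<^sup>2 \<le> d + 1 / real (Suc n)"
      using y(2) less_imp_le by blast
  qed
  then have min: "(norm (x - p))\<^sup>2 \<le> (norm (x - p - t *\<^sub>R h))\<^sup>2" if "h \<in> S" for t h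
  proof -
    have "d \<le> (norm (x - (p + t *\<^sub>R h)))\<^sup>2"
      using that p(1) assms(2) by (intro lower subspace_add subspace_scale)
    with \<open>(norm (x - p))\<^sup>2 \<le> d + 0\<close> show ?thesis
      by (simp only: diff_diff_add)
  qed
  have "inner (x - p) h = 0" if "h \<in> S" for h
  proof (cases "h = 0")
    case False
    \<comment> \<open>The minimizer of the quadratic polynomial that sends t to the squared norm of
      \<open>x - p - t *\<^sub>R h\<close>.\<close>
    define t where "t = inner (x - p) h / (norm h)\<^sup>2"
    have "(norm (x - p - t *\<^sub>R h))\<^sup>2 = (norm (x - p))\<^sup>2 - (inner (x - p) h)\<^sup>2 / (norm h)\<^sup>2"
    proof -
      have "(norm (x - p - t *\<^sub>R h))\<^sup>2 = (norm (x - p))\<^sup>2 - 2 * t * inner (x - p) h + t\<^sup>2 * (norm h)\<^sup>2"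
        unfolding power2_norm_eq_inner
        by (simp add: inner_diff_left inner_diff_right inner_commute power2_eq_square algebra_simps)
      also have "\<dots> = (norm (x - p))\<^sup>2 - (inner (x - p) h)\<^sup>2 / (norm h)\<^sup>2"
        using False by (simp add: t_def field_simps power2_eq_square)
      finally show ?thesis .
    qed
    with min[OF that, of t] have "(inner (x - p) h)\<^sup>2 / (norm h)\<^sup>2 \<le> 0"
      by simp
    then show ?thesis
      using False by (simp add: divide_le_0_iff)
  qed simp
  with p(1) show ?thesis by blast
qed

definition complex_subspace :: "L2_circle set \<Rightarrow> bool" where
  "complex_subspace K \<longleftrightarrow>
     0 \<in> K \<and> (\<forall>x\<in>K. \<forall>y\<in>K. x + y \<in> K) \<and> (\<forall>c. \<forall>x\<in>K. cscale c x \<in> K)"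

lemma complex_subspace_diff:
  "complex_subspace K \<Longrightarrow> x \<in> K \<Longrightarrow> y \<in> K \<Longrightarrow> x - y \<in> K"
  unfolding complex_subspace_def diff_conv_add_uminus uminus_eq_cscale by blast

lemma complex_subspace_sum:
  "complex_subspace K \<Longrightarrow> (\<And>i. i \<in> I \<Longrightarrow> f i \<in> K) \<Longrightarrow> (\<Sum>i\<in>I. f i) \<in> K"
  by (induction I rule: infinite_finite_induct) (auto simp: complex_subspace_def)

lemma orth_proj_unique:
  assumes K: "complex_subspace K" and "g \<in> K" "\<And>h. h \<in> K \<Longrightarrow> cinner (f - g) h = 0"
  shows "orth_proj K f = g"
  unfolding orth_proj_def
proof (rule the_equality)
  fix g' assume g': "g' \<in> K \<and> (\<forall>h\<in>K. cinner (f - g') h = 0)"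
  then have "g' - g \<in> K"
    using K assms(2) by (intro complex_subspace_diff) auto
  then have "cinner (f - g) (g' - g) - cinner (f - g') (g' - g) = 0"
    using g' assms(3) by auto
  then have "cinner (g' - g) (g' - g) = 0"
    by (simp add: cinner_diff_left)
  then show "g' = g"
    by (simp add: cinner_self)
qed (use assms in auto)

lemma orth_proj:
  assumes K: "complex_subspace K" and "closed K"
  shows orth_proj_mem: "orth_proj K f \<in> K"
    and cinner_orth_proj_diff: "h \<in> K \<Longrightarrow> cinner (f - orth_proj K f) h = 0"
proof -
  have "complete K"
    using complete_L2_circle complete_closed_subset[OF assms(2), of UNIV] by simp
  moreover have "subspace K"
    using K by (auto simp: subspace_def complex_subspace_def scaleR_L2_circle_def)
  ultimately obtain g where g: "g \<in> K" "\<And>h. h \<in> K \<Longrightarrow> inner (f - g) h = 0"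
    using orthogonal_projection_exists[of K f] by blast
  have "cinner (f - g) h = 0" if h: "h \<in> K" for h
  proof (rule complex_eqI)
    show "Re (cinner (f - g) h) = Re 0"
      using g(2)[OF h] by (simp add: inner_L2_circle_def)
    \<comment> \<open>The real part of the product with i h is the imaginary part of the product
      with h, so real orthogonality to a complex subspace is complex orthogonality.\<close>
    have "cscale \<i> h \<in> K"
      using K h by (auto simp: complex_subspace_def)
    from g(2)[OF this] show "Im (cinner (f - g) h) = Im 0"
      by (simp add: inner_L2_circle_def cinner_cscale_right)
  qed
  note g = g(1) this
  have "orth_proj K f = g"
    using K g by (intro orth_proj_unique)
  then show "orth_proj K f \<in> K" "h \<in> K \<Longrightarrow> cinner (f - orth_proj K f) h = 0"
    using g by simp_all
qed

text \<open>Since \<open>w\<close> is orthogonal to \<open>K\<close>, the vectors \<open>f\<close>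
  and \<open>f - w\<close> have the same projection. Applied to an element \<open>w\<close> of
  \<open>mult_H2 \<Theta>\<close> close to z^n, this is how \<open>P (monomial n)\<close> is shown
  to be small.\<close>

lemma norm_orth_proj_le_dist:
  assumes K: "complex_subspace K" "closed K" and w: "\<And>h. h \<in> K \<Longrightarrow> cinner h w = 0"
  shows "norm (orth_proj K f) \<le> norm (f - w)"
proof -
  let ?p = "orth_proj K f"
  have "cinner (f - ?p) ?p = 0" "cinner ?p w = 0"
    using K w by (auto intro: cinner_orth_proj_diff orth_proj_mem)
  moreover have "cinner w ?p = 0"
    using \<open>cinner ?p w = 0\<close> by (metis cinner_commute complex_cnj_zero)
  ultimately have "cinner ?p (f - ?p - w) = 0"
    by (metis cinner_commute cinner_diff_right complex_cnj_zero diff_zero)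
  from norm_add_orthogonal[OF this] have "(norm ?p)\<^sup>2 \<le> (norm (f - w))\<^sup>2"
    by (simp add: algebra_simps)
  then show ?thesis
    by (rule power2_le_imp_le) simp
qed

lemma norm_orth_proj_le:
  assumes "complex_subspace K" "closed K"
  shows "norm (orth_proj K f) \<le> norm f"
  using norm_orth_proj_le_dist[OF assms, of 0 f] by simp

section \<open>The Hardy space\<close>

definition monomial :: "nat \<Rightarrow> L2_circle" where
  "monomial n = L2_of (\<lambda>z. z ^ n)"

definition partial_sum :: "nat \<Rightarrow> L2_circle \<Rightarrow> L2_circle" where
  "partial_sum n g = (\<Sum>k<n. cscale (cinner g (monomial k)) (monomial k))"

text \<open>The closed span of the monomials with nonnegative exponent, described by convergence of
  the Fourier series so that polynomial approximants are at hand. It turns out to be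
  \<open>H2\<close>.\<close>

definition power_series_space :: "L2_circle set" where
  "power_series_space = {g. (\<lambda>n. partial_sum n g) \<longlonglongrightarrow> g}"

lemma square_integrable_power: "square_integrable (\<lambda>z. z ^ n)"
  by (intro square_integrable_continuous continuous_intros)

lemma shift_monomial [simp]: "shift (monomial n) = monomial (Suc n)"
  by (simp add: monomial_def shift_L2_of square_integrable_power)

text \<open>The shift is unitary, so both exponents can be lowered together until one of them is 0;
  what remains is the mean of a power of z.\<close>

lemma cinner_monomial [simp]: "cinner (monomial m) (monomial n) = (if m = n then 1 else 0)"
proof (induction m n rule: diff_induct)
  case (1 m)
  have "(\<integral>z. 1 \<partial>circle_measure) = complex_of_real 1"
    by (subst lebesgue_integral_const) simp_all
  then show ?case
    using integral_circle_measure_power[of m]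
    by (auto simp: monomial_def cinner_L2_of square_integrable_power square_integrable_power[of 0, simplified])
next
  case (2 n)
  have "cinner (monomial (Suc n)) (monomial 0) = 0"
    using integral_circle_measure_power[of "Suc n"]
    unfolding monomial_def cinner_L2_of[OF square_integrable_power square_integrable_power]
    by simp
  then show ?case
    by (subst cinner_commute) simp
next
  case (3 m n)
  have "cinner (monomial (Suc m)) (monomial (Suc n)) = cinner (monomial m) (monomial n)"
    unfolding shift_monomial[symmetric] cinner_shift_left cshift_shift ..
  with 3 show ?case by simp
qed

lemma norm_monomial [simp]: "norm (monomial n) = 1"
  by (simp add: norm_L2_circle_def)

lemma cinner_sum_monomial:
  assumes "finite I"
  shows "cinner (\<Sum>k\<in>I. cscale (a k) (monomial k)) (monomial j) = (if j \<in> I then a j else 0)"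
proof -
  have "cinner (\<Sum>k\<in>I. cscale (a k) (monomial k)) (monomial j) = (\<Sum>k\<in>I. if j = k then a k else 0)"
    unfolding cinner_sum_left by (intro sum.cong) (auto simp: cinner_cscale_left)
  then show ?thesis
    using assms by (simp add: sum.delta)
qed

lemma norm_sum_monomial:
  assumes "finite I"
  shows "(norm (\<Sum>k\<in>I. cscale (a k) (monomial k)))\<^sup>2 = (\<Sum>k\<in>I. (cmod (a k))\<^sup>2)"
proof -
  have "complex_of_real ((norm (\<Sum>k\<in>I. cscale (a k) (monomial k)))\<^sup>2) = (\<Sum>k\<in>I. cnj (a k) * a k)"
    unfolding cinner_self[symmetric] cinner_sum_right using assms
    by (intro sum.cong refl) (simp add: cinner_cscale_right cinner_sum_monomial)
  also have "\<dots> = complex_of_real (\<Sum>k\<in>I. (cmod (a k))\<^sup>2)"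
    unfolding of_real_sum complex_norm_square by (simp add: mult.commute)
  finally show ?thesis
    by (simp only: of_real_eq_iff)
qed

lemma cinner_partial_sum: "cinner (partial_sum n g) (monomial j) = (if j < n then cinner g (monomial j) else 0)"
  unfolding partial_sum_def by (simp add: cinner_sum_monomial)

lemma partial_sum_add: "partial_sum n (g + h) = partial_sum n g + partial_sum n h"
  by (simp add: partial_sum_def cinner_add_left cscale_add_left sum.distrib)

lemma partial_sum_cscale: "partial_sum n (cscale c g) = cscale c (partial_sum n g)"
  by (simp add: partial_sum_def cinner_cscale_left cscale_sum)

lemma partial_sum_diff: "partial_sum n (g - h) = partial_sum n g - partial_sum n h"
  by (simp only: diff_conv_add_uminus uminus_eq_cscale partial_sum_add partial_sum_cscale)

lemma norm_partial_sum_pythagoras: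
  "(norm g)\<^sup>2 = (norm (partial_sum n g))\<^sup>2 + (norm (g - partial_sum n g))\<^sup>2"
proof -
  have "cinner (g - partial_sum n g) (partial_sum n g) = 0"
    by (subst (2) partial_sum_def)
       (simp add: cinner_sum_right cinner_cscale_right cinner_diff_left cinner_partial_sum)
  from norm_add_orthogonal[OF this] show ?thesis by simp
qed

lemma norm_residual_le: "norm (g - partial_sum n g) \<le> norm g"
  by (rule power2_le_imp_le) (simp_all add: norm_partial_sum_pythagoras[of g n])

lemma power_series_space_residual:
  assumes "g \<in> power_series_space"
  shows "(\<lambda>n. norm (g - partial_sum n g)) \<longlonglongrightarrow> 0"
proof -
  have "(\<lambda>n. norm (g - partial_sum n g)) \<longlonglongrightarrow> norm (g - g)"
    using assms unfolding power_series_space_def by (intro tendsto_intros) simp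
  then show ?thesis by simp
qed

text \<open>Passing to the residual \<open>g - partial_sum n g\<close> is a contraction for every
  \<open>n\<close>, so the residual of the limit is controlled by that of a nearby
  \<open>X j\<close>, uniformly in \<open>n\<close>.\<close>

lemma closed_power_series_space: "closed power_series_space"
  unfolding closed_sequential_limits
proof (intro allI impI, elim conjE)
  fix X g assume X: "\<forall>j. X j \<in> power_series_space" and lim: "X \<longlonglongrightarrow> g"
  have "(\<lambda>n. partial_sum n g) \<longlonglongrightarrow> g"
  proof (rule LIMSEQ_I)
    fix e :: real assume "e > 0"
    then obtain j where j: "norm (X j - g) < e / 2"
      using LIMSEQ_D[OF lim, of "e / 2"] by auto
    obtain N where N: "\<And>n. n \<ge> N \<Longrightarrow> norm (X j - partial_sum n (X j)) < e / 2"
      using LIMSEQ_D[OF power_series_space_residual, of "X j" "e / 2"] X \<open>e > 0\<close> by auto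
    have "norm (partial_sum n g - g) < e" if "n \<ge> N" for n
    proof -
      have "g - partial_sum n g = (X j - partial_sum n (X j)) - (X j - g - partial_sum n (X j - g))"
        by (simp add: partial_sum_diff)
      then have "norm (g - partial_sum n g) \<le>
          norm (X j - partial_sum n (X j)) + norm (X j - g - partial_sum n (X j - g))"
        by (simp only: norm_triangle_ineq4)
      also have "\<dots> < e / 2 + e / 2"
        using N[OF that] j norm_residual_le[of "X j - g" n] by linarith
      finally show ?thesis by (simp add: norm_minus_commute)
    qed
    then show "\<exists>N. \<forall>n\<ge>N. norm (partial_sum n g - g) < e" by blast
  qed
  then show "g \<in> power_series_space" by (simp add: power_series_space_def)
qed

lemma complex_subspace_power_series_space: "complex_subspace power_series_space"
  unfolding complex_subspace_def power_series_space_def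
  by (auto simp: partial_sum_add partial_sum_cscale intro!: tendsto_intros)
     (simp add: partial_sum_def)

lemma monomial_in_power_series_space: "monomial k \<in> power_series_space"
proof -
  have "partial_sum n (monomial k) = monomial k" if "n \<ge> Suc k" for n
  proof -
    have "partial_sum n (monomial k) = (\<Sum>j<n. if j = k then monomial j else 0)"
      unfolding partial_sum_def by (intro sum.cong) auto
    then show ?thesis using that by (simp add: sum.delta')
  qed
  then show ?thesis
    unfolding power_series_space_def
    by (auto intro!: tendsto_eventually eventually_sequentiallyI[of "Suc k"])
qed

lemma sum_monomial_in_power_series_space: "(\<Sum>k\<in>I. cscale (a k) (monomial k)) \<in> power_series_space"
  using complex_subspace_power_series_space monomial_in_power_series_space
  by (intro complex_subspace_sum) (auto simp: complex_subspace_def)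

lemma sum_monomial_eq_L2_of:
  "(\<Sum>k<n. cscale (a k) (monomial k)) = L2_of (\<lambda>z. \<Sum>k<n. a k * z ^ k)"
proof (induction n)
  case 0
  then show ?case by (simp add: zero_L2_circle_def)
next
  case (Suc n)
  have "square_integrable (\<lambda>z. \<Sum>k<n. a k * z ^ k)" "square_integrable (\<lambda>z. a n * z ^ n)"
    by (intro square_integrable_continuous continuous_intros)+
  with Suc show ?case
    by (simp add: monomial_def cscale_L2_of square_integrable_power L2_of_add)
qed

lemma norm_L2_of_le:
  assumes "square_integrable f" "M \<ge> 0" "AE z in circle_measure. cmod (f z) \<le> M"
  shows "norm (L2_of f) \<le> M"
proof (rule power2_le_imp_le)
  interpret finite_measure circle_measure by (rule finite_measure_circle_measure)
  have "(norm (L2_of f))\<^sup>2 = (\<integral>z. (cmod (f z))\<^sup>2 \<partial>circle_measure)"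
    by (rule norm_L2_of) fact
  also have "\<dots> \<le> (\<integral>z. M\<^sup>2 \<partial>circle_measure)"
  proof (rule integral_mono_AE)
    show "AE z in circle_measure. (cmod (f z))\<^sup>2 \<le> M\<^sup>2"
      using assms(3) by eventually_elim (simp add: power_mono)
  qed (use assms(1) in \<open>auto simp: square_integrable_def\<close>)
  finally show "(norm (L2_of f))\<^sup>2 \<le> M\<^sup>2" by simp
qed fact

section \<open>Dilates of holomorphic functions and the identification of \<open>H2\<close>\<close>

lemma continuous_on_dilate:
  assumes "f holomorphic_on ball 0 1" "0 \<le> r" "r < 1"
  shows "continuous_on (sphere 0 1) (\<lambda>z. f (of_real r * z))"
  by (rule continuous_on_compose2[OF holomorphic_on_imp_continuous_on[OF assms(1)]])
     (use assms in \<open>auto intro!: continuous_intros simp: norm_mult\<close>)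

lemma square_integrable_dilate:
  assumes "f holomorphic_on ball 0 1" "0 \<le> r" "r < 1"
  shows "square_integrable (\<lambda>z. f (of_real r * z))"
  by (rule square_integrable_continuous[OF continuous_on_dilate[OF assms]])

text \<open>On a circle of radius below 1 the power series converges uniformly, and on a space of
  total mass 1 the supremum bounds the L^2 norm.\<close>

lemma dilate_sums:
  assumes sums: "\<And>w. w \<in> ball 0 1 \<Longrightarrow> (\<lambda>k. a k * w ^ k) sums f w" and r: "0 \<le> r" "r < 1"
  shows "(\<lambda>n. \<Sum>k<n. cscale (a k * of_real r ^ k) (monomial k)) \<longlonglongrightarrow> L2_of (\<lambda>z. f (of_real r * z))"
proof (rule LIMSEQ_I)
  fix e :: real assume "e > 0"
  have f: "f holomorphic_on ball 0 1"
    by (rule power_series_holomorphic[where a = a]) (use sums in auto)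
  \<comment> \<open>Convergence at a larger radius \<open>s\<close> gives the absolute convergence
    at radius \<open>r\<close> that the M-test requires.\<close>
  obtain s where s: "r < s" "s < 1"
    using dense r(2) by blast
  have "summable (\<lambda>k. a k * of_real s ^ k)"
    using sums[of "of_real s"] s r by (intro sums_summable) auto
  then have "summable (\<lambda>k. norm (a k * of_real r ^ k))"
    by (rule powser_insidea) (use s r in auto)
  then have "uniform_limit (sphere 0 1) (\<lambda>n z. \<Sum>k<n. a k * (of_real r * z) ^ k)
      (\<lambda>z. suminf (\<lambda>k. a k * (of_real r * z) ^ k)) sequentially"
    by (intro Weierstrass_m_test[where M = "\<lambda>k. norm (a k * of_real r ^ k)"])
       (auto simp: norm_mult norm_power power_mult_distrib)
  also have "?this \<longleftrightarrow> uniform_limit (sphere 0 1) (\<lambda>n z. \<Sum>k<n. a k * (of_real r * z) ^ k)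
      (\<lambda>z. f (of_real r * z)) sequentially"
    using sums r by (intro uniform_limit_cong') (auto simp: norm_mult sums_iff)
  finally have "\<forall>\<^sub>F n in sequentially. \<forall>z\<in>sphere 0 1.
      dist (\<Sum>k<n. a k * (of_real r * z) ^ k) (f (of_real r * z)) < e / 2"
    using half_gt_zero[OF \<open>e > 0\<close>] unfolding uniform_limit_iff by blast
  then obtain N where N: "\<And>n z. n \<ge> N \<Longrightarrow> z \<in> sphere 0 1 \<Longrightarrow>
      dist (\<Sum>k<n. a k * (of_real r * z) ^ k) (f (of_real r * z)) < e / 2"
    unfolding eventually_sequentially by blast
  have "norm ((\<Sum>k<n. cscale (a k * of_real r ^ k) (monomial k)) - L2_of (\<lambda>z. f (of_real r * z))) < e"
    if "n \<ge> N" for n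
  proof -
    have sq: "square_integrable (\<lambda>z. \<Sum>k<n. a k * of_real r ^ k * z ^ k)"
      by (intro square_integrable_continuous continuous_intros)
    note sqf = square_integrable_dilate[OF f r]
    have "norm (L2_of (\<lambda>z. (\<Sum>k<n. a k * of_real r ^ k * z ^ k) - f (of_real r * z))) \<le> e / 2"
    proof (rule norm_L2_of_le)
      show "AE z in circle_measure. cmod ((\<Sum>k<n. a k * of_real r ^ k * z ^ k) - f (of_real r * z)) \<le> e / 2"
        using N[OF that] by (intro AE_I2) (force simp: dist_norm power_mult_distrib mult.assoc)
    qed (use \<open>e > 0\<close> sq sqf in \<open>auto intro: square_integrable_diff\<close>)
    then show ?thesis
      using \<open>e > 0\<close> by (simp add: sum_monomial_eq_L2_of L2_of_diff sq sqf)
  qed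
  then show "\<exists>N. \<forall>n\<ge>N. norm ((\<Sum>k<n. cscale (a k * of_real r ^ k) (monomial k)) -
      L2_of (\<lambda>z. f (of_real r * z))) < e" by blast
qed

lemma dilate_in_power_series_space:
  assumes f: "f holomorphic_on ball 0 1" and r: "0 \<le> r" "r < 1"
  shows "L2_of (\<lambda>z. f (of_real r * z)) \<in> power_series_space"
proof (rule Lim_in_closed_set[OF closed_power_series_space])
  show "(\<lambda>n. \<Sum>k<n. cscale ((deriv ^^ k) f 0 / fact k * of_real r ^ k) (monomial k))
      \<longlonglongrightarrow> L2_of (\<lambda>z. f (of_real r * z))"
    using holomorphic_power_series[OF f] r by (intro dilate_sums) auto
  show "\<forall>\<^sub>F n in sequentially.
      (\<Sum>k<n. cscale ((deriv ^^ k) f 0 / fact k * of_real r ^ k) (monomial k)) \<in> power_series_space"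
    by (intro always_eventually allI sum_monomial_in_power_series_space)
qed simp

lemma eventually_at_left_1: "\<forall>\<^sub>F r in at_left (1::real). 0 \<le> r \<and> r < 1"
  by (rule eventually_at_leftI[of 0]) auto

lemma boundary_values_subset:
  assumes "\<And>f. f \<in> F \<Longrightarrow> f holomorphic_on ball 0 1"
  shows "boundary_values F \<subseteq> power_series_space"
proof
  fix g assume "g \<in> boundary_values F"
  then obtain f where f: "f \<in> F" and lim: "((\<lambda>r. L2_of (\<lambda>z. f (of_real r * z))) \<longlongrightarrow> g) (at_left (1::real))"
    by (auto simp: boundary_values_def)
  show "g \<in> power_series_space"
  proof (rule Lim_in_closed_set[OF closed_power_series_space _ _ lim])
    show "\<forall>\<^sub>F r in at_left (1::real). L2_of (\<lambda>z. f (of_real r * z)) \<in> power_series_space"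
      using eventually_at_left_1
      by eventually_elim (use assms[OF f] in \<open>auto intro: dilate_in_power_series_space\<close>)
  qed simp
qed

lemma summable_coefficients:
  assumes "w \<in> ball 0 1"
  shows "summable (\<lambda>k. cinner g (monomial k) * w ^ k)"
proof (rule summable_comparison_test')
  show "summable (\<lambda>k. norm g * norm w ^ k)"
    using assms by (intro summable_mult summable_geometric) auto
  show "norm (cinner g (monomial k) * w ^ k) \<le> norm g * norm w ^ k" if "k \<ge> 0" for k
    using norm_cinner_le[of g "monomial k"] by (auto simp: norm_mult norm_power intro!: mult_right_mono)
qed

text \<open>The holomorphic function is the power series built from the Fourier coefficients of
  \<open>g\<close>. Its dilate at radius r has the damped coefficients a_k r^k, so norms of dilates
  and of their tails are dominated by those of \<open>g\<close>.\<close>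

lemma power_series_space_subset_H2: "power_series_space \<subseteq> H2"
proof
  fix g assume g: "g \<in> power_series_space"
  define a where "a k = cinner g (monomial k)" for k
  define f where "f w = (\<Sum>k. a k * w ^ k)" for w
  have sums: "(\<lambda>k. a k * w ^ k) sums f w" if "w \<in> ball 0 1" for w
    using summable_coefficients[OF that] by (simp add: f_def a_def summable_sums)
  have hol: "f holomorphic_on ball 0 1"
    by (rule power_series_holomorphic[where a = a]) (use sums in auto)
  define D where "D r = L2_of (\<lambda>z. f (of_real r * z))" for r :: real
  define s where "s n r = (\<Sum>k<n. cscale (a k * of_real r ^ k) (monomial k))" for n and r :: real
  have s_lim: "(\<lambda>n. s n r) \<longlonglongrightarrow> D r" if "0 \<le> r" "r < 1" for r
    unfolding s_def D_def using sums that by (rule dilate_sums)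
  have s_1: "s n 1 = partial_sum n g" for n
    by (simp add: s_def partial_sum_def a_def)
  have s_diff: "norm (s m r - s n r) \<le> norm (s m 1 - s n 1)" if "0 \<le> r" "r \<le> 1" "n \<le> m" for m n r
  proof (rule power2_le_imp_le)
    have diff: "s m r - s n r = (\<Sum>k\<in>{n..<m}. cscale (a k * of_real r ^ k) (monomial k))" for r
      using sum_diff_nat_ivl[of 0 n m "\<lambda>k. cscale (a k * of_real r ^ k) (monomial k)"] that(3)
      by (simp add: s_def atLeast0LessThan)
    have "(cmod (a k * of_real r ^ k))\<^sup>2 \<le> (cmod (a k * of_real 1 ^ k))\<^sup>2" for k
      using that power_le_one[of r k]
      by (intro power_mono) (auto simp: norm_mult norm_power mult_left_le)
    then show "(norm (s m r - s n r))\<^sup>2 \<le> (norm (s m 1 - s n 1))\<^sup>2"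
      unfolding diff by (subst (1 2) norm_sum_monomial) (auto intro!: sum_mono)
  qed simp
  \<comment> \<open>Letting m tend to infinity in \<open>s_diff\<close> gives a tail bound uniform
    in \<open>r\<close>. With \<open>n\<close> = 0 it bounds the square means; with large
    \<open>n\<close> it lets the limits in \<open>n\<close> and \<open>r\<close> be
    exchanged.\<close>
  have D_diff: "norm (D r - s n r) \<le> norm (g - partial_sum n g)" if "0 \<le> r" "r < 1" for n r
  proof (rule LIMSEQ_le)
    show "(\<lambda>m. norm (s m r - s n r)) \<longlonglongrightarrow> norm (D r - s n r)"
      using s_lim that by (intro tendsto_intros)
    show "(\<lambda>m. norm (s m 1 - s n 1)) \<longlonglongrightarrow> norm (g - partial_sum n g)"
      unfolding s_1 using g by (intro tendsto_intros) (simp add: power_series_space_def)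
    show "\<exists>N. \<forall>m\<ge>N. norm (s m r - s n r) \<le> norm (s m 1 - s n 1)"
      using s_diff that by (intro exI[of _ n]) auto
  qed
  have "f \<in> hardy_disk"
    unfolding hardy_disk_def
  proof (intro CollectI conjI hol bdd_aboveI2)
    fix r :: real assume r: "r \<in> {0..<1}"
    have "norm (D r) \<le> norm g"
      using D_diff[of r 0] r by (simp add: s_def partial_sum_def)
    then have "(norm (D r))\<^sup>2 \<le> (norm g)\<^sup>2" by (simp add: power_mono)
    moreover have "(norm (D r))\<^sup>2 = (\<integral>z. (cmod (f (of_real r * z)))\<^sup>2 \<partial>circle_measure)"
      using r by (simp add: D_def norm_L2_of square_integrable_dilate[OF hol])
    ultimately show "(\<integral>z. (cmod (f (of_real r * z)))\<^sup>2 \<partial>circle_measure) \<le> (norm g)\<^sup>2"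
      by simp
  qed
  moreover have "(D \<longlongrightarrow> g) (at_left 1)"
  proof (rule tendstoI)
    fix e :: real assume "e > 0"
    then obtain n where n: "norm (g - partial_sum n g) < e / 3"
      using LIMSEQ_D[OF power_series_space_residual[OF g], of "e / 3"] by auto
    have "((\<lambda>r. s n r) \<longlongrightarrow> s n 1) (at_left 1)"
      unfolding s_def by (intro tendsto_intros)
    then have "\<forall>\<^sub>F r in at_left 1. dist (s n r) (s n 1) < e / 3"
      using \<open>e > 0\<close> by (intro tendstoD) auto
    with eventually_at_left_1 show "\<forall>\<^sub>F r in at_left 1. dist (D r) g < e"
    proof eventually_elim
      case (elim r)
      have "D r - g = (D r - s n r) + (s n r - s n 1) - (g - partial_sum n g)"
        by (simp add: s_1)
      then have "norm (D r - g) \<le> norm (D r - s n r) + norm (s n r - s n 1) + norm (g - partial_sum n g)"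
        using norm_triangle_ineq4 norm_triangle_ineq order_trans add_right_mono by metis
      with elim n D_diff[of r n] show ?case
        by (simp add: dist_norm)
    qed
  qed
  ultimately show "g \<in> H2"
    unfolding H2_def boundary_values_def D_def by blast
qed

lemma H2_eq: "H2 = power_series_space"
proof
  show "H2 \<subseteq> power_series_space"
    unfolding H2_def by (rule boundary_values_subset) (simp add: hardy_disk_def)
qed (rule power_series_space_subset_H2)

lemma bounded_in_hardy_disk:
  assumes f: "f holomorphic_on ball 0 1" and "bounded (f ` ball 0 1)"
  shows "f \<in> hardy_disk"
proof -
  obtain M where M: "M > 0" "\<And>z. z \<in> ball 0 1 \<Longrightarrow> cmod (f z) \<le> M"
    using assms(2) by (auto simp: bounded_pos)
  show ?thesis
    unfolding hardy_disk_def
  proof (intro CollectI conjI f bdd_aboveI2)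
    fix r :: real assume r: "r \<in> {0..<1}"
    note sq = square_integrable_dilate[OF f, of r]
    have "norm (L2_of (\<lambda>z. f (of_real r * z))) \<le> M"
      using r M by (intro norm_L2_of_le sq AE_I2 M) (auto simp: norm_mult)
    then have "(norm (L2_of (\<lambda>z. f (of_real r * z))))\<^sup>2 \<le> M\<^sup>2"
      by (simp add: power_mono)
    then show "(\<integral>z. (cmod (f (of_real r * z)))\<^sup>2 \<partial>circle_measure) \<le> M\<^sup>2"
      using r by (simp add: norm_L2_of sq)
  qed
qed

lemma mult_z_in_hardy_disk:
  assumes "f \<in> hardy_disk"
  shows "(\<lambda>z. z * f z) \<in> hardy_disk"
proof -
  have f: "f holomorphic_on ball 0 1"
    using assms by (simp add: hardy_disk_def)
  then have zf: "(\<lambda>z. z * f z) holomorphic_on ball 0 1"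
    by (intro holomorphic_intros)
  obtain M where M: "\<And>r. r \<in> {0..<1} \<Longrightarrow> (\<integral>z. (cmod (f (of_real r * z)))\<^sup>2 \<partial>circle_measure) \<le> M"
    using assms unfolding hardy_disk_def bdd_above_def by blast
  show ?thesis
    unfolding hardy_disk_def
  proof (intro CollectI conjI zf bdd_aboveI2)
    fix r :: real assume r: "r \<in> {0..<1}"
    have "(\<integral>z. (cmod (of_real r * z * f (of_real r * z)))\<^sup>2 \<partial>circle_measure) \<le>
        (\<integral>z. (cmod (f (of_real r * z)))\<^sup>2 \<partial>circle_measure)"
    proof (rule integral_mono)
      show "integrable circle_measure (\<lambda>z. (cmod (of_real r * z * f (of_real r * z)))\<^sup>2)"
        "integrable circle_measure (\<lambda>z. (cmod (f (of_real r * z)))\<^sup>2)"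
        using square_integrable_dilate[OF zf, of r] square_integrable_dilate[OF f, of r] r
        by (simp_all add: square_integrable_def)
      show "(cmod (of_real r * z * f (of_real r * z)))\<^sup>2 \<le> (cmod (f (of_real r * z)))\<^sup>2"
        if "z \<in> space circle_measure" for z
        using r that by (intro power_mono) (auto simp: norm_mult mult_left_le_one_le)
    qed
    also have "\<dots> \<le> M" using r by (rule M)
    finally show "(\<integral>z. (cmod (of_real r * z * f (of_real r * z)))\<^sup>2 \<partial>circle_measure) \<le> M" .
  qed
qed

text \<open>The bridge between the radial limits in \<open>inner_function\<close> and the
  mean-square limits in \<open>boundary_values\<close>: dominated convergence with a constant
  majorant, along arbitrary sequences of radii tending to 1.\<close>

lemma bounded_dilates_tendsto:
  assumes f: "f holomorphic_on ball 0 1" and "bounded (f ` ball 0 1)"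
    and t: "t \<in> borel_measurable circle_measure"
    and lim: "AE z in circle_measure. ((\<lambda>r. f (of_real r * z)) \<longlongrightarrow> t z) (at_left (1::real))"
  shows "square_integrable t"
    and "((\<lambda>r. L2_of (\<lambda>z. f (of_real r * z))) \<longlongrightarrow> L2_of t) (at_left (1::real))"
proof -
  have [measurable]: "t \<in> borel_measurable circle_measure" by fact
  obtain M where M: "M > 0" "\<And>z. z \<in> ball 0 1 \<Longrightarrow> cmod (f z) \<le> M"
    using assms(2) by (auto simp: bounded_pos)
  have bound: "cmod (f (of_real r * z)) \<le> M" if "0 \<le> r" "r < 1" "z \<in> sphere 0 1" for r z
    using that by (intro M(2)) (auto simp: norm_mult)
  have t_le: "AE z in circle_measure. cmod (t z) \<le> M"
    using lim AE_space
  proof eventually_elim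
    case (elim z)
    have "\<forall>\<^sub>F r in at_left (1::real). cmod (f (of_real r * z)) \<le> M"
      using eventually_at_left_1 by eventually_elim (use elim(2) in \<open>auto intro: bound\<close>)
    then show ?case
      using tendsto_upperbound[OF tendsto_norm[OF elim(1)]] by simp
  qed
  show sqt: "square_integrable t"
    using t t_le by (rule square_integrable_bounded)
  show "((\<lambda>r. L2_of (\<lambda>z. f (of_real r * z))) \<longlongrightarrow> L2_of t) (at_left (1::real))"
  proof (rule tendsto_at_left_sequentially[of 0])
    fix S :: "nat \<Rightarrow> real" assume S: "\<And>n. S n < 1" "\<And>n. 0 < S n" "S \<longlonglongrightarrow> 1"
    have "S n \<in> {..<1} \<and> S n \<noteq> 1" for n
      using S(1)[of n] by auto
    with S(3) have S': "filterlim S (at_left 1) sequentially"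
      by (simp add: filterlim_at)
    have sq: "square_integrable (\<lambda>z. f (of_real (S n) * z))" for n
      using S by (intro square_integrable_dilate[OF f]) (auto intro: less_imp_le)
    then have [measurable]: "(\<lambda>z. f (of_real (S n) * z)) \<in> borel_measurable circle_measure" for n
      by (simp add: square_integrable_def)
    have "(\<lambda>n. \<integral>z. (cmod (f (of_real (S n) * z) - t z))\<^sup>2 \<partial>circle_measure)
        \<longlonglongrightarrow> (\<integral>z. 0 \<partial>circle_measure)"
    proof (rule integral_dominated_convergence[where w = "\<lambda>_. (2 * M)\<^sup>2"])
      interpret finite_measure circle_measure by (rule finite_measure_circle_measure)
      show "integrable circle_measure (\<lambda>_. (2 * M)\<^sup>2)" by simp
      show "AE z in circle_measure. (\<lambda>n. (cmod (f (of_real (S n) * z) - t z))\<^sup>2) \<longlonglongrightarrow> 0"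
        using lim
      proof eventually_elim
        case (elim z)
        have "(\<lambda>n. (cmod (f (of_real (S n) * z) - t z))\<^sup>2) \<longlonglongrightarrow> (cmod (t z - t z))\<^sup>2"
          by (intro tendsto_intros filterlim_compose[OF elim S'])
        then show ?case by simp
      qed
      show "AE z in circle_measure. norm ((cmod (f (of_real (S n) * z) - t z))\<^sup>2) \<le> (2 * M)\<^sup>2" for n
        using t_le AE_space
      proof eventually_elim
        case (elim z)
        have "cmod (f (of_real (S n) * z) - t z) \<le> M + M"
          using norm_triangle_ineq4[of "f (of_real (S n) * z)" "t z"] bound[of "S n" z] S elim
          by (smt (verit) space_circle_measure)
        then have "(cmod (f (of_real (S n) * z) - t z))\<^sup>2 \<le> (2 * M)\<^sup>2"
          by (intro power_mono) auto
        then show ?case by simp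
      qed
    qed measurable
    then have "(\<lambda>n. sqrt ((norm (L2_of (\<lambda>z. f (of_real (S n) * z)) - L2_of t))\<^sup>2)) \<longlonglongrightarrow> sqrt 0"
      by (intro tendsto_intros) (simp add: L2_of_diff sq sqt norm_L2_of square_integrable_diff)
    then show "(\<lambda>n. L2_of (\<lambda>z. f (of_real (S n) * z))) \<longlonglongrightarrow> L2_of t"
      by (simp add: tendsto_norm_zero_iff LIM_zero_iff)
  qed simp
qed

section \<open>Model spaces\<close>

text \<open>On \<open>H2\<close> this is (h - h(0)) / z. The formula makes sense on all of L^2 and
  is a contraction there, so norm bounds for its powers carry no membership conditions.\<close>

definition backward_shift :: "L2_circle \<Rightarrow> L2_circle" where
  "backward_shift h = cshift (h - cscale (cinner h (monomial 0)) (monomial 0))"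

lemma backward_shift_add: "backward_shift (x + y) = backward_shift x + backward_shift y"
  by (simp add: backward_shift_def cinner_add_left cscale_add_left algebra_simps flip: cshift_add)

lemma backward_shift_cscale: "backward_shift (cscale c x) = cscale c (backward_shift x)"
  by (simp add: backward_shift_def cinner_cscale_left cscale_diff_right flip: cshift_cscale)

lemma norm_backward_shift_le: "norm (backward_shift x) \<le> norm x"
  using norm_residual_le[of x 1] by (simp add: backward_shift_def partial_sum_def)

lemma bounded_linear_backward_shift: "bounded_linear backward_shift"
  by (rule bounded_linear_intro[where K = 1])
     (simp_all add: backward_shift_add backward_shift_cscale scaleR_L2_circle_def norm_backward_shift_le)

lemma shift_pow_monomial: "(shift ^^ n) (monomial k) = monomial (n + k)"
  by (induction n) simp_all

lemma linear_shift_pow: "linear (shift ^^ n)"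
proof (induction n)
  case (Suc n)
  then show ?case
    using linear_compose[OF Suc bounded_linear.linear[OF bounded_linear_shift]] by (simp add: o_def)
qed (simp add: linear_id[unfolded id_def])

lemma shift_pow_diff: "(shift ^^ n) (x - y) = (shift ^^ n) x - (shift ^^ n) y"
  by (rule linear_diff[OF linear_shift_pow])

lemma shift_pow_cscale: "(shift ^^ n) (cscale c x) = cscale c ((shift ^^ n) x)"
  by (induction n) (simp_all add: shift_cscale)

lemma norm_shift_pow [simp]: "norm ((shift ^^ n) x) = norm x"
  by (induction n) simp_all

lemma cinner_shift_pow: "cinner ((shift ^^ n) x) ((shift ^^ n) y) = cinner x y"
  by (induction n) (simp_all add: cinner_shift_left)

text \<open>The backward shifts strip off the coefficients 0 to n - 1 one at a time. As the shift is
  isometric, the norm of the n-th power at \<open>x\<close> is that of a Fourier residual, whence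
  the strong convergence to 0 on \<open>H2\<close>.\<close>

lemma shift_pow_backward_shift_pow: "(shift ^^ n) ((backward_shift ^^ n) x) = x - partial_sum n x"
proof (induction n)
  case (Suc n)
  let ?y = "(backward_shift ^^ n) x"
  have "cinner ?y (monomial 0) = cinner (x - partial_sum n x) (monomial n)"
    using cinner_shift_pow[of n ?y "monomial 0"] by (simp add: Suc shift_pow_monomial)
  then have "cinner ?y (monomial 0) = cinner x (monomial n)"
    by (simp add: cinner_diff_left cinner_partial_sum)
  moreover have "(shift ^^ Suc n) ((backward_shift ^^ Suc n) x) =
      (shift ^^ n) (?y - cscale (cinner ?y (monomial 0)) (monomial 0))"
    by (simp add: funpow_swap1[of shift] backward_shift_def)
  ultimately show ?case
    by (simp add: shift_pow_diff shift_pow_cscale shift_pow_monomial Suc partial_sum_def)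
qed (simp add: partial_sum_def)

lemma backward_shift_pow_tendsto_0:
  assumes "x \<in> power_series_space"
  shows "(\<lambda>n. (backward_shift ^^ n) x) \<longlonglongrightarrow> 0"
proof -
  have "norm ((backward_shift ^^ n) x) = norm (x - partial_sum n x)" for n
    using norm_shift_pow[of n "(backward_shift ^^ n) x"]
    by (simp only: shift_pow_backward_shift_pow)
  with power_series_space_residual[OF assms] show ?thesis
    by - (rule tendsto_norm_zero_cancel, simp)
qed

lemma cinner_shift_monomial_0:
  assumes "x \<in> power_series_space"
  shows "cinner (shift x) (monomial 0) = 0"
proof (rule LIMSEQ_unique)
  show "(\<lambda>n. cinner (shift (partial_sum n x)) (monomial 0)) \<longlonglongrightarrow> cinner (shift x) (monomial 0)"
    using assms unfolding power_series_space_def by (intro tendsto_intros) simp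
  have "shift (partial_sum n x) = (\<Sum>k<n. cscale (cinner x (monomial k)) (monomial (Suc k)))" for n
    unfolding partial_sum_def
    by (simp add: linear_sum[OF bounded_linear.linear[OF bounded_linear_shift]] shift_cscale)
  then show "(\<lambda>n. cinner (shift (partial_sum n x)) (monomial 0)) \<longlonglongrightarrow> 0"
    by (simp add: cinner_sum_left cinner_cscale_left)
qed

lemma shift_in_power_series_space:
  assumes "x \<in> power_series_space"
  shows "shift x \<in> power_series_space"
proof (rule Lim_in_closed_set[OF closed_power_series_space])
  show "(\<lambda>n. shift (partial_sum n x)) \<longlonglongrightarrow> shift x"
    using assms unfolding power_series_space_def by (intro tendsto_intros) simp
  show "\<forall>\<^sub>F n in sequentially. shift (partial_sum n x) \<in> power_series_space"
    unfolding partial_sum_def linear_sum[OF bounded_linear.linear[OF bounded_linear_shift]]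
    using complex_subspace_power_series_space monomial_in_power_series_space
    by (intro always_eventually allI complex_subspace_sum) (auto simp: shift_cscale complex_subspace_def)
qed simp

lemma backward_shift_monomial: "backward_shift (monomial k) \<in> power_series_space"
proof (cases k)
  case 0
  then show ?thesis
    using complex_subspace_power_series_space
    by (simp add: backward_shift_def complex_subspace_def linear_0[OF bounded_linear.linear[OF bounded_linear_cshift]])
next
  case (Suc j)
  have "cshift (monomial (Suc j)) = monomial j"
    by (metis cshift_shift shift_monomial)
  with Suc show ?thesis
    by (simp add: backward_shift_def monomial_in_power_series_space)
qed

lemma backward_shift_in_power_series_space:
  assumes "x \<in> power_series_space"
  shows "backward_shift x \<in> power_series_space"
proof (rule Lim_in_closed_set[OF closed_power_series_space])
  show "(\<lambda>n. backward_shift (partial_sum n x)) \<longlonglongrightarrow> backward_shift x"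
    using assms unfolding power_series_space_def
    by (intro bounded_linear.tendsto[OF bounded_linear_backward_shift]) simp
  show "\<forall>\<^sub>F n in sequentially. backward_shift (partial_sum n x) \<in> power_series_space"
    unfolding partial_sum_def linear_sum[OF bounded_linear.linear[OF bounded_linear_backward_shift]]
    using complex_subspace_power_series_space backward_shift_monomial
    by (intro always_eventually allI complex_subspace_sum) (auto simp: backward_shift_cscale complex_subspace_def)
qed simp

section \<open>The model space of an inner function and its compressed shift\<close>

locale inner_fun =
  fixes \<Theta> :: "complex \<Rightarrow> complex"
  assumes inner: "inner_function \<Theta>"
begin

abbreviation K :: "L2_circle set" where "K \<equiv> model_space \<Theta>"
abbreviation P :: "L2_circle \<Rightarrow> L2_circle" where "P \<equiv> orth_proj K"
abbreviation T :: "L2_circle \<Rightarrow> L2_circle" where "T \<equiv> compressed_shift \<Theta>"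

lemma holomorphic: "\<Theta> holomorphic_on ball 0 1"
  and bounded: "bounded (\<Theta> ` ball 0 1)"
  using inner by (simp_all add: inner_function_def)

lemma mult_H2_holomorphic: "f \<in> hardy_disk \<Longrightarrow> (\<lambda>z. \<Theta> z * f z) holomorphic_on ball 0 1"
  using holomorphic by (intro holomorphic_intros) (simp_all add: hardy_disk_def)

lemma mult_H2_subset: "mult_H2 \<Theta> \<subseteq> power_series_space"
  unfolding mult_H2_def by (rule boundary_values_subset) (auto intro: mult_H2_holomorphic)

text \<open>Multiplying by z amounts to replacing f by z f. The dilate of z f carries an additional
  factor r, which tends to 1.\<close>

lemma shift_in_mult_H2:
  assumes "w \<in> mult_H2 \<Theta>"
  shows "shift w \<in> mult_H2 \<Theta>"
proof -
  obtain f where f: "f \<in> hardy_disk"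
    and lim: "((\<lambda>r. L2_of (\<lambda>z. \<Theta> (of_real r * z) * f (of_real r * z))) \<longlongrightarrow> w) (at_left (1::real))"
    using assms by (auto simp: mult_H2_def boundary_values_def)
  have "((\<lambda>r. cscale (of_real r) (shift (L2_of (\<lambda>z. \<Theta> (of_real r * z) * f (of_real r * z)))))
      \<longlongrightarrow> cscale (of_real 1) (shift w)) (at_left (1::real))"
    unfolding scaleR_L2_circle_def[symmetric] by (intro tendsto_intros lim)
  moreover have "\<forall>\<^sub>F r in at_left (1::real).
      cscale (of_real r) (shift (L2_of (\<lambda>z. \<Theta> (of_real r * z) * f (of_real r * z)))) =
      L2_of (\<lambda>z. \<Theta> (of_real r * z) * (of_real r * z * f (of_real r * z)))"
    using eventually_at_left_1
  proof eventually_elim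
    case (elim r)
    have sq: "square_integrable (\<lambda>z. \<Theta> (of_real r * z) * f (of_real r * z))"
      using square_integrable_dilate[OF mult_H2_holomorphic[OF f]] elim by blast
    show ?case
      by (simp add: shift_L2_of[OF sq] cscale_L2_of square_integrable_shift[OF sq])
         (simp add: mult_ac)
  qed
  ultimately have "((\<lambda>r. L2_of (\<lambda>z. \<Theta> (of_real r * z) * (of_real r * z * f (of_real r * z))))
      \<longlongrightarrow> cscale (of_real 1) (shift w)) (at_left (1::real))"
    by (rule Lim_transform_eventually)
  then have "((\<lambda>r. L2_of (\<lambda>z. \<Theta> (of_real r * z) * (of_real r * z * f (of_real r * z))))
      \<longlongrightarrow> shift w) (at_left (1::real))"
    by simp
  then show ?thesis
    unfolding mult_H2_def boundary_values_def using mult_z_in_hardy_disk[OF f] by auto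
qed

lemma complex_subspace_K: "complex_subspace K"
  using complex_subspace_power_series_space
  by (auto simp: complex_subspace_def model_space_def H2_eq cinner_add_left cinner_cscale_left)

lemma closed_K: "closed K"
proof -
  have "closed ((\<lambda>g. cinner g h) -` {0})" for h
    by (intro continuous_closed_vimage linear_continuous_at bounded_linear_cinner_left) simp
  then have "closed (power_series_space \<inter> (\<Inter>h\<in>mult_H2 \<Theta>. (\<lambda>g. cinner g h) -` {0}))"
    by (intro closed_Int closed_power_series_space closed_INT) auto
  also have "power_series_space \<inter> (\<Inter>h\<in>mult_H2 \<Theta>. (\<lambda>g. cinner g h) -` {0}) = K"
    by (auto simp: model_space_def H2_eq)
  finally show ?thesis .
qed

lemma K_subset: "x \<in> K \<Longrightarrow> x \<in> power_series_space"
  by (simp add: model_space_def H2_eq)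

lemma P_mem [simp]: "P x \<in> K"
  by (rule orth_proj_mem[OF complex_subspace_K closed_K])

lemma cinner_P_left: "h \<in> K \<Longrightarrow> cinner (P x) h = cinner x h"
  using cinner_orth_proj_diff[OF complex_subspace_K closed_K, of h x] by (simp add: cinner_diff_left)

lemma P_eqI: "g \<in> K \<Longrightarrow> (\<And>h. h \<in> K \<Longrightarrow> cinner x h = cinner g h) \<Longrightarrow> P x = g"
  by (rule orth_proj_unique[OF complex_subspace_K]) (simp_all add: cinner_diff_left)

lemma P_id: "x \<in> K \<Longrightarrow> P x = x"
  by (rule P_eqI) simp_all

lemma P_add: "P (x + y) = P x + P y"
  using complex_subspace_K
  by (intro P_eqI) (auto simp: cinner_add_left cinner_P_left complex_subspace_def)

lemma P_cscale: "P (cscale c x) = cscale c (P x)"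
  using complex_subspace_K
  by (intro P_eqI) (auto simp: cinner_cscale_left cinner_P_left complex_subspace_def)

lemma norm_P_le: "norm (P x) \<le> norm x"
  by (rule norm_orth_proj_le[OF complex_subspace_K closed_K])

lemma bounded_linear_P: "bounded_linear P"
  by (rule bounded_linear_intro[where K = 1])
     (simp_all add: P_add P_cscale scaleR_L2_circle_def norm_P_le)

lemma T_eq: "T x = P (shift x)"
  by (simp add: compressed_shift_def)

lemma bounded_linear_T: "bounded_linear T"
  using bounded_linear_compose[OF bounded_linear_P bounded_linear_shift]
  by (simp add: T_eq[abs_def])

lemma norm_T_le: "norm (T x) \<le> norm x"
  using norm_P_le[of "shift x"] by (simp add: T_eq)

text \<open>The adjoint of the shift preserves the orthogonal complement of the shift-invariant set
  \<open>mult_H2 \<Theta>\<close>; the subtracted constant does no harm, since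
  \<open>shift w\<close> is orthogonal to constants.\<close>

lemma backward_shift_in_K:
  assumes "h \<in> K"
  shows "backward_shift h \<in> K"
proof -
  have "cinner (backward_shift h) w = 0" if w: "w \<in> mult_H2 \<Theta>" for w
  proof -
    have "cinner (monomial 0) (shift w) = 0"
      using cinner_shift_monomial_0[of w] mult_H2_subset w by (subst cinner_commute) auto
    moreover have "cinner h (shift w) = 0"
      using assms shift_in_mult_H2[OF w] by (simp add: model_space_def)
    ultimately show ?thesis
      by (simp add: backward_shift_def cinner_cshift_left cinner_diff_left cinner_cscale_left)
  qed
  with assms show ?thesis
    by (simp add: model_space_def H2_eq backward_shift_in_power_series_space)
qed

text \<open>For \<open>x\<close> in \<open>H2\<close> the constant coefficient of
  \<open>shift x\<close> vanishes, so the constant term removed from \<open>h\<close> does not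
  affect the product. The condition falls on \<open>x\<close> alone; \<open>h\<close> is
  arbitrary.\<close>

lemma cinner_shift_eq:
  assumes "x \<in> power_series_space"
  shows "cinner (shift x) h = cinner x (backward_shift h)"
  using cinner_shift_monomial_0[OF assms]
  by (simp add: backward_shift_def cinner_diff_right cinner_cscale_right flip: cinner_shift_left)

lemma compressed_shift_adj_eq:
  assumes h: "h \<in> K"
  shows "compressed_shift_adj \<Theta> h = backward_shift h"
  unfolding compressed_shift_adj_def adjoint_on_def
proof (rule the_equality)
  have adj: "cinner (T f) h = cinner f (backward_shift h)" if "f \<in> K" for f
    using h that by (simp add: T_eq cinner_P_left cinner_shift_eq K_subset)
  then show "backward_shift h \<in> K \<and> (\<forall>f\<in>K. cinner (T f) h = cinner f (backward_shift h))"
    using backward_shift_in_K[OF h] by blast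
  fix g assume g: "g \<in> K \<and> (\<forall>f\<in>K. cinner (T f) h = cinner f g)"
  then have d: "g - backward_shift h \<in> K"
    using complex_subspace_diff[OF complex_subspace_K] backward_shift_in_K[OF h] by blast
  then have "cinner (g - backward_shift h) (g - backward_shift h) = 0"
    using g adj[OF d] by (simp add: cinner_diff_right)
  then show "g = backward_shift h"
    by (simp add: cinner_self)
qed

lemma backward_shift_pow_in_K: "h \<in> K \<Longrightarrow> (backward_shift ^^ n) h \<in> K"
  by (induction n) (simp_all add: backward_shift_in_K)

lemma compressed_shift_adj_pow: "h \<in> K \<Longrightarrow> (compressed_shift_adj \<Theta> ^^ n) h = (backward_shift ^^ n) h"
  by (induction n) (simp_all add: compressed_shift_adj_eq backward_shift_pow_in_K)

lemma T_in_K: "T x \<in> K"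
  by (simp add: T_eq)

lemma T_pow_in_K: "x \<in> K \<Longrightarrow> (T ^^ n) x \<in> K"
  by (induction n) (simp_all add: T_in_K)

text \<open>Invariance of \<open>K\<close> under the backward shift means that \<open>P\<close>
  annihilates the shift of \<open>x - P x\<close>. Iterating this trades powers of \<open>T\<close>
  for powers of the shift under a single projection.\<close>

lemma T_P:
  assumes "x \<in> power_series_space"
  shows "T (P x) = P (shift x)"
  unfolding T_eq
  by (rule P_eqI)
     (use assms in \<open>simp_all add: cinner_P_left cinner_shift_eq K_subset backward_shift_in_K\<close>)

lemma T_pow_P:
  assumes "x \<in> power_series_space"
  shows "(T ^^ n) (P x) = P ((shift ^^ n) x)"
proof (induction n)
  case (Suc n)
  have "(shift ^^ n) x \<in> power_series_space"
    by (induction n) (simp_all add: assms shift_in_power_series_space)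
  then show ?case by (simp add: Suc T_P)
qed simp

text \<open>The shift undoes \<open>backward_shift\<close> up to the constant term, and
  \<open>P\<close> fixes \<open>f\<close>; only the projection of that constant term
  remains.\<close>

lemma T_backward_shift:
  assumes "f \<in> K"
  shows "f - T (backward_shift f) = cscale (cinner f (monomial 0)) (P (monomial 0))"
  using assms
  by (simp add: T_eq backward_shift_def P_id P_cscale linear_diff[OF bounded_linear.linear[OF bounded_linear_P]])

text \<open>On the circle \<open>\<bar>z\<^sup>n - \<Theta> p\<bar> = \<bar>\<Theta> - s\<bar>\<close> for \<open>p = z\<^sup>n cnj s\<close>, and for the \<open>n\<close>-th Taylor polynomial
  \<open>s\<close> of \<open>\<Theta>\<close> this \<open>p\<close> is again a polynomial; so \<open>z\<^sup>n\<close> is asymptotically in \<open>\<Theta>H\<^sup>2\<close>.\<close>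

lemma P_monomial_tendsto_0: "(\<lambda>n. P (monomial n)) \<longlonglongrightarrow> 0"
proof -
  \<comment> \<open>A limit along one fixed sequence of radii is a measurable function; almost
    everywhere it agrees with the full radial limit.\<close>
  define t where "t z = lim (\<lambda>n. \<Theta> (of_real (1 - 1 / real (n + 2)) * z))" for z
  have [measurable]: "(\<lambda>z. \<Theta> (of_real (1 - 1 / real (n + 2)) * z)) \<in> borel_measurable circle_measure" for n
    by (intro borel_measurable_circle_measure continuous_on_dilate holomorphic) auto
  have t: "t \<in> borel_measurable circle_measure"
    unfolding t_def[abs_def] by (rule borel_measurable_lim_metric) measurable
  have approach: "filterlim (\<lambda>n. 1 - 1 / real (n + 2)) (at_left 1) sequentially"
    by real_asymp
  have "AE z in circle_measure. \<exists>l. ((\<lambda>r. \<Theta> (of_real r * z)) \<longlongrightarrow> l) (at_left (1::real)) \<and> cmod l = 1"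
    using inner by (simp add: inner_function_def)
  then have lim: "AE z in circle_measure.
      ((\<lambda>r. \<Theta> (of_real r * z)) \<longlongrightarrow> t z) (at_left (1::real)) \<and> cmod (t z) = 1"
  proof eventually_elim
    case (elim z)
    then obtain l where l: "((\<lambda>r. \<Theta> (of_real r * z)) \<longlongrightarrow> l) (at_left (1::real))" "cmod l = 1"
      by blast
    have "t z = l"
      unfolding t_def by (rule limI) (rule filterlim_compose[OF l(1) approach])
    with l show ?case by simp
  qed
  then have lim': "AE z in circle_measure. ((\<lambda>r. \<Theta> (of_real r * z)) \<longlongrightarrow> t z) (at_left (1::real))"
    by eventually_elim simp
  note sqt = bounded_dilates_tendsto(1)[OF holomorphic bounded t lim']
  define b where "b = L2_of t"
  have b: "b \<in> power_series_space"
  proof -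
    have "b \<in> boundary_values {\<Theta>}"
      unfolding boundary_values_def b_def
      using bounded_dilates_tendsto(2)[OF holomorphic bounded t lim'] by auto
    then show ?thesis
      using boundary_values_subset[of "{\<Theta>}"] holomorphic by auto
  qed
  define c where "c k = cinner b (monomial k)" for k
  define p where "p n z = (\<Sum>k<n. cnj (c k) * z ^ (n - k))" for n and z :: complex
  have p_cont: "continuous_on A (p n)" for A n
    unfolding p_def by (intro continuous_intros)
  have p_hol: "p n holomorphic_on A" for A n
    unfolding p_def by (intro holomorphic_intros)
  have p_bdd: "bounded (p n ` ball 0 1)" for n
    by (rule bounded_subset[of "p n ` cball 0 1"])
       (auto intro!: compact_imp_bounded compact_continuous_image p_cont)
  define w where "w n = L2_of (\<lambda>z. t z * p n z)" for n
  have tp: "(\<lambda>z. t z * p n z) \<in> borel_measurable circle_measure" for n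
    using t borel_measurable_circle_measure[OF p_cont] by measurable
  have tp_bdd: "bounded ((\<lambda>z. \<Theta> z * p n z) ` ball 0 1)" for n
  proof -
    obtain M N where "\<forall>z\<in>ball 0 1. cmod (\<Theta> z) \<le> M" "\<forall>z\<in>ball 0 1. cmod (p n z) \<le> N"
      using bounded p_bdd[of n] by (auto simp: bounded_iff)
    then show ?thesis
      unfolding bounded_iff
      by (intro exI[of _ "M * N"]) (auto simp: norm_mult intro!: mult_mono intro: order_trans[OF norm_ge_zero])
  qed
  have tp_lim: "AE z in circle_measure.
      ((\<lambda>r. \<Theta> (of_real r * z) * p n (of_real r * z)) \<longlongrightarrow> t z * p n z) (at_left (1::real))" for n
    using lim'
  proof eventually_elim
    case (elim z)
    have "((\<lambda>r. p n (of_real r * z)) \<longlongrightarrow> p n (of_real 1 * z)) (at_left (1::real))"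
      unfolding p_def by (intro tendsto_intros)
    with elim show ?case
      by (intro tendsto_mult) simp_all
  qed
  have tp_hol: "(\<lambda>z. \<Theta> z * p n z) holomorphic_on ball 0 1" for n
    by (intro holomorphic_intros holomorphic p_hol)
  note sqtp = bounded_dilates_tendsto(1)[OF tp_hol tp_bdd tp tp_lim]
  have w: "w n \<in> mult_H2 \<Theta>" for n
    unfolding mult_H2_def boundary_values_def w_def
    using bounded_in_hardy_disk[OF p_hol p_bdd] bounded_dilates_tendsto(2)[OF tp_hol tp_bdd tp tp_lim]
    by auto
  have "norm (monomial n - w n) = norm (b - partial_sum n b)" for n
  proof -
    define s where "s z = (\<Sum>k<n. c k * z ^ k)" for z :: complex
    have sqs: "square_integrable s"
      unfolding s_def by (intro square_integrable_continuous continuous_intros)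
    have s: "partial_sum n b = L2_of s"
      by (simp add: partial_sum_def sum_monomial_eq_L2_of s_def[abs_def] flip: c_def)
    have p_eq: "p n z = z ^ n * cnj (s z)" if "cmod z = 1" for z
    proof -
      have zz: "z * cnj z = 1" using that complex_norm_square[of z] by simp
      have "z ^ (n - k) = z ^ n * cnj z ^ k" if "k < n" for k
      proof -
        have "z ^ n * cnj z ^ k = z ^ (n - k) * (z * cnj z) ^ k"
          using that by (simp add: power_mult_distrib power_add[symmetric] mult.assoc[symmetric])
        then show ?thesis by (simp add: zz)
      qed
      then show ?thesis
        by (simp add: p_def s_def sum_distrib_left mult_ac)
    qed
    have "(norm (monomial n - w n))\<^sup>2 = (\<integral>z. (cmod (z ^ n - t z * p n z))\<^sup>2 \<partial>circle_measure)"
      unfolding monomial_def w_def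
      by (simp add: L2_of_diff square_integrable_power sqtp norm_L2_of square_integrable_diff)
    also have "\<dots> = (\<integral>z. (cmod (t z - s z))\<^sup>2 \<partial>circle_measure)"
    proof (rule integral_cong_AE)
      show "AE z in circle_measure. (cmod (z ^ n - t z * p n z))\<^sup>2 = (cmod (t z - s z))\<^sup>2"
        using lim AE_space
      proof eventually_elim
        case (elim z)
        then have z: "cmod z = 1" and tz: "t z * cnj (t z) = 1"
          using complex_norm_square[of "t z"] by simp_all
        \<comment> \<open>Unimodularity enters here: writing z^n as z^n t cnj t makes t a common
          factor of modulus 1.\<close>
        have "z ^ n - t z * p n z = z ^ n * (t z * cnj (t z - s z))"
          using tz by (simp add: p_eq[OF z] algebra_simps)
        then show ?case
          using z elim by (simp add: norm_mult norm_power flip: complex_cnj_diff)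
      qed
    qed (use square_integrable_diff[OF square_integrable_power sqtp] square_integrable_diff[OF sqt sqs]
         in \<open>auto simp: square_integrable_def\<close>)
    also have "\<dots> = (norm (b - partial_sum n b))\<^sup>2"
      unfolding s by (simp add: b_def L2_of_diff sqt sqs norm_L2_of square_integrable_diff)
    finally show ?thesis by (simp add: power2_eq_iff_nonneg)
  qed
  moreover have "norm (P (monomial n)) \<le> norm (monomial n - w n)" for n
    using w by (intro norm_orth_proj_le_dist complex_subspace_K closed_K) (simp add: model_space_def)
  ultimately have "norm (P (monomial n)) \<le> norm (b - partial_sum n b)" for n
    by metis
  then show ?thesis
    by (intro Lim_null_comparison[OF _ power_series_space_residual[OF b]] always_eventually) simp
qed

text \<open>The residual of \<open>f\<close> after a Fourier partial sum stays small under the shift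
  powers followed by \<open>P\<close>, as these are contractions; on the finite sum the claim is
  that of the monomials.\<close>

lemma T_pow_tendsto_0:
  assumes "f \<in> K"
  shows "(\<lambda>n. (T ^^ n) f) \<longlonglongrightarrow> 0"
proof (rule LIMSEQ_I)
  fix e :: real assume "e > 0"
  obtain N where N: "norm (f - partial_sum N f) < e / 2"
    using LIMSEQ_D[OF power_series_space_residual[OF K_subset[OF assms]], of "e / 2"] \<open>e > 0\<close> by auto
  define q where "q n = P ((shift ^^ n) (partial_sum N f))" for n
  have q: "q n = (\<Sum>k<N. cscale (cinner f (monomial k)) (P (monomial (n + k))))" for n
    unfolding q_def partial_sum_def linear_sum[OF linear_shift_pow]
    by (simp add: linear_sum[OF bounded_linear.linear[OF bounded_linear_P]] shift_pow_cscale
        shift_pow_monomial P_cscale)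
  have "(\<lambda>n. \<Sum>k<N. cscale (cinner f (monomial k)) (P (monomial (n + k))))
      \<longlonglongrightarrow> (\<Sum>k<N. cscale (cinner f (monomial k)) 0)"
    by (intro tendsto_sum tendsto_cscale LIMSEQ_ignore_initial_segment P_monomial_tendsto_0)
  then have "q \<longlonglongrightarrow> 0" unfolding q[abs_def] by simp
  then obtain M where M: "\<And>n. n \<ge> M \<Longrightarrow> norm (q n) < e / 2"
    using LIMSEQ_D[of q 0 "e / 2"] \<open>e > 0\<close> by auto
  have "norm ((T ^^ n) f - 0) < e" if "n \<ge> M" for n
  proof -
    have "(T ^^ n) f = P ((shift ^^ n) f)"
      using T_pow_P[OF K_subset[OF assms]] by (simp add: P_id assms)
    also have "\<dots> = P ((shift ^^ n) (f - partial_sum N f)) + q n"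
      by (simp add: q_def shift_pow_diff flip: P_add)
    finally have "norm ((T ^^ n) f) \<le> norm (P ((shift ^^ n) (f - partial_sum N f))) + norm (q n)"
      by (simp add: norm_triangle_ineq)
    also have "norm (P ((shift ^^ n) (f - partial_sum N f))) \<le> norm (f - partial_sum N f)"
      using norm_P_le[of "(shift ^^ n) (f - partial_sum N f)"] by simp
    finally show ?thesis using N M[OF that] by simp
  qed
  then show "\<exists>M. \<forall>n\<ge>M. norm ((T ^^ n) f - 0) < e" by blast
qed

end

section \<open>Operator norm and compactness\<close>

text \<open>The real \<open>SUP\<close> carries information only over nonempty sets that are bounded
  above; the two premises guarantee this and allow all later work with vectors in the unit
  ball.\<close>

lemma op_norm_tendsto_on_iff:
  assumes "0 \<in> K" and bdd: "\<And>n. \<exists>C. \<forall>f\<in>K. norm f \<le> 1 \<longrightarrow> norm (X n f - B f) \<le> C"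
  shows "op_norm_tendsto_on K X B \<longleftrightarrow>
    (\<forall>e>0. \<exists>N. \<forall>n\<ge>N. \<forall>f\<in>K. norm f \<le> 1 \<longrightarrow> norm (X n f - B f) \<le> e)"
proof -
  have bdd': "bdd_above ((\<lambda>f. norm (X n f - B f)) ` {f\<in>K. norm f \<le> 1})" for n
    using bdd[of n] by (auto simp: bdd_above_def)
  have upper: "norm (X n f - B f) \<le> op_norm_on K (\<lambda>f. X n f - B f)" if "f \<in> K" "norm f \<le> 1" for n f
    unfolding op_norm_on_def using that by (intro cSUP_upper bdd') auto
  have nonneg: "0 \<le> op_norm_on K (\<lambda>f. X n f - B f)" for n
    using upper[of 0 n] assms(1) by (simp add: order_trans[OF norm_ge_zero])
  have least: "op_norm_on K (\<lambda>f. X n f - B f) \<le> e"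
    if "\<And>f. f \<in> K \<Longrightarrow> norm f \<le> 1 \<Longrightarrow> norm (X n f - B f) \<le> e" for n e
    unfolding op_norm_on_def using that assms(1) by (intro cSUP_least) auto
  show ?thesis
    unfolding op_norm_tendsto_on_def
  proof (intro iffI allI impI)
    fix e :: real assume "e > 0" "(\<lambda>n. op_norm_on K (\<lambda>f. X n f - B f)) \<longlonglongrightarrow> 0"
    from LIMSEQ_D[OF this(2,1)] obtain N where
      "\<forall>n\<ge>N. norm (op_norm_on K (\<lambda>f. X n f - B f) - 0) < e"
      by blast
    then have "\<forall>n\<ge>N. op_norm_on K (\<lambda>f. X n f - B f) < e"
      by (simp add: abs_less_iff)
    then show "\<exists>N. \<forall>n\<ge>N. \<forall>f\<in>K. norm f \<le> 1 \<longrightarrow> norm (X n f - B f) \<le> e"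
      using upper by (meson less_imp_le order_trans)
  next
    assume unif: "\<forall>e>0. \<exists>N. \<forall>n\<ge>N. \<forall>f\<in>K. norm f \<le> 1 \<longrightarrow> norm (X n f - B f) \<le> e"
    show "(\<lambda>n. op_norm_on K (\<lambda>f. X n f - B f)) \<longlonglongrightarrow> 0"
    proof (rule LIMSEQ_I)
      fix e :: real assume "e > 0"
      then obtain N where "\<forall>n\<ge>N. \<forall>f\<in>K. norm f \<le> 1 \<longrightarrow> norm (X n f - B f) \<le> e / 2"
        using unif half_gt_zero by blast
      then have "op_norm_on K (\<lambda>f. X n f - B f) \<le> e / 2" if "n \<ge> N" for n
        using that by (intro least) blast
      then have "norm (op_norm_on K (\<lambda>f. X n f - B f) - 0) < e" if "n \<ge> N" for n
        using that nonneg[of n] \<open>e > 0\<close> by fastforce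
      then show "\<exists>N. \<forall>n\<ge>N. norm (op_norm_on K (\<lambda>f. X n f - B f) - 0) < e" by blast
    qed
  qed
qed

text \<open>The set form of the fact that norm limits of compact operators are compact: total
  boundedness passes from the approximating sets to \<open>S\<close>, and completeness does the
  rest.\<close>

lemma compact_closure_approx:
  fixes S :: "L2_circle set"
  assumes approx: "\<And>e. e > 0 \<Longrightarrow> \<exists>C. compact C \<and> (\<forall>x\<in>S. \<exists>c\<in>C. dist x c \<le> e)"
  shows "compact (closure S)"
  unfolding compact_eq_totally_bounded
proof (intro conjI allI impI)
  show "complete (closure S)"
    using complete_closed_subset[OF closed_closure _ complete_L2_circle] by simp
  fix e :: real assume "e > 0"
  \<comment> \<open>Three errors are added up: from the closure to \<open>S\<close>, from
    \<open>S\<close> to \<open>C\<close>, and from \<open>C\<close> to a finite net.\<close>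
  then have "e / 4 > 0" by simp
  from approx[OF this] obtain C where C: "compact C" "\<And>x. x \<in> S \<Longrightarrow> \<exists>c\<in>C. dist x c \<le> e / 4"
    by blast
  obtain k where k: "finite k" "C \<subseteq> (\<Union>x\<in>k. ball x (e / 4))"
    using C(1) \<open>e / 4 > 0\<close> unfolding compact_eq_totally_bounded by blast
  have "closure S \<subseteq> (\<Union>x\<in>k. ball x e)"
  proof
    fix x assume "x \<in> closure S"
    then obtain y where y: "y \<in> S" "dist y x < e / 4"
      using \<open>e / 4 > 0\<close> closure_approachable by blast
    obtain c where c: "c \<in> C" "dist y c \<le> e / 4"
      using C(2) y(1) by blast
    obtain z where z: "z \<in> k" "dist z c < e / 4"
      using k(2) c(1) by auto
    have "dist z x < e"
      using y c z \<open>e > 0\<close> dist_triangle[of z x c] dist_triangle[of c x y]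
      by (simp add: dist_commute)
    with z show "x \<in> (\<Union>x\<in>k. ball x e)" by auto
  qed
  with k(1) show "\<exists>k. finite k \<and> closure S \<subseteq> (\<Union>x\<in>k. ball x e)" by blast
qed

section \<open>Defect operators of the powers of the compressed shift\<close>

context inner_fun
begin

lemma linear_T_pow: "linear (T ^^ n)"
proof (induction n)
  case (Suc n)
  then show ?case
    using linear_compose[OF Suc bounded_linear.linear[OF bounded_linear_T]] by (simp add: o_def)
qed (simp add: linear_id[unfolded id_def])

lemma norm_T_pow_le: "norm ((T ^^ n) x) \<le> norm x"
  by (induction n) (auto intro: order_trans[OF norm_T_le])

lemma bounded_linear_T_pow: "bounded_linear (T ^^ n)"
  using linear_add[OF linear_T_pow] linear_scale[OF linear_T_pow] norm_T_pow_le
  by (intro bounded_linear_intro[where K = 1]) simp_all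

lemma linear_backward_shift_pow: "linear (backward_shift ^^ n)"
proof (induction n)
  case (Suc n)
  then show ?case
    using linear_compose[OF Suc bounded_linear.linear[OF bounded_linear_backward_shift]]
    by (simp add: o_def)
qed (simp add: linear_id[unfolded id_def])

lemma norm_backward_shift_pow_le: "norm ((backward_shift ^^ n) x) \<le> norm x"
  by (induction n) (auto intro: order_trans[OF norm_backward_shift_le])

lemma bounded_linear_backward_shift_pow: "bounded_linear (backward_shift ^^ n)"
  using linear_add[OF linear_backward_shift_pow] linear_scale[OF linear_backward_shift_pow]
    norm_backward_shift_pow_le
  by (intro bounded_linear_intro[where K = 1]) simp_all

lemma zero_in_K [simp]: "0 \<in> K"
  using complex_subspace_K by (simp add: complex_subspace_def)

lemma diff_in_K: "x \<in> K \<Longrightarrow> y \<in> K \<Longrightarrow> x - y \<in> K"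
  by (rule complex_subspace_diff[OF complex_subspace_K])

definition defect :: "nat \<Rightarrow> L2_circle \<Rightarrow> L2_circle" where
  "defect n f = f - (T ^^ n) ((backward_shift ^^ n) f)"

lemma defect_in_K: "f \<in> K \<Longrightarrow> defect n f \<in> K"
  unfolding defect_def by (intro diff_in_K T_pow_in_K backward_shift_pow_in_K)

text \<open>Each step adds one rank-one term, namely \<open>T ^^ n\<close> applied to the rank-one
  defect of \<open>(backward_shift ^^ n) f\<close>. Finite rank is recorded as balls being mapped
  into compact sets, the new scalar ranging over a closed disk. The radius is free because the
  defect is later taken both of unit vectors and of values of \<open>A\<close>.\<close>

lemma defect_compact: "\<exists>C. compact C \<and> (\<forall>f\<in>K. norm f \<le> R \<longrightarrow> defect n f \<in> C)"
proof (induction n)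
  case 0
  show ?case by (intro exI[of _ "{0}"]) (simp add: defect_def)
next
  case (Suc n)
  then obtain C where C: "compact C" "\<And>f. f \<in> K \<Longrightarrow> norm f \<le> R \<Longrightarrow> defect n f \<in> C"
    by blast
  define D where "D = (\<lambda>c. (T ^^ n) (cscale c (P (monomial 0)))) ` cball 0 R"
  have "compact D"
    unfolding D_def
    by (intro compact_continuous_image compact_cball linear_continuous_on
        bounded_linear_compose[OF bounded_linear_T_pow bounded_linear_cscale_left])
  then have "compact {x + y |x y. x \<in> C \<and> y \<in> D}"
    by (intro compact_sums C)
  moreover have "defect (Suc n) f \<in> {x + y |x y. x \<in> C \<and> y \<in> D}" if f: "f \<in> K" "norm f \<le> R" for f
  proof -
    define g where "g = (backward_shift ^^ n) f"
    have g: "g \<in> K" "norm g \<le> R"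
      using f norm_backward_shift_pow_le[of n f] by (auto simp: g_def backward_shift_pow_in_K)
    have "defect (Suc n) f = defect n f + (T ^^ n) (g - T (backward_shift g))"
      by (simp add: defect_def g_def linear_diff[OF linear_T_pow] funpow_swap1[of T])
    also have "g - T (backward_shift g) = cscale (cinner g (monomial 0)) (P (monomial 0))"
      by (rule T_backward_shift[OF g(1)])
    finally have "defect (Suc n) f =
        defect n f + (T ^^ n) (cscale (cinner g (monomial 0)) (P (monomial 0)))" .
    moreover have "cinner g (monomial 0) \<in> cball 0 R"
      using norm_cinner_le[of g "monomial 0"] g(2) by simp
    ultimately show ?thesis
      using C(2)[OF f] unfolding D_def by blast
  qed
  ultimately show ?case by blast
qed

end

section \<open>The implications for a bounded operator on the model space\<close>

locale model_operator = inner_fun +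
  fixes A :: "L2_circle \<Rightarrow> L2_circle"
  assumes A: "bounded_operator_on K A"
begin

abbreviation A_seq :: "nat \<Rightarrow> L2_circle \<Rightarrow> L2_circle" where
  "A_seq \<equiv> \<lambda>n. (compressed_shift_adj \<Theta> ^^ n) \<circ> A \<circ> (T ^^ n)"

lemma A_in_K: "f \<in> K \<Longrightarrow> A f \<in> K"
  using A by (simp add: bounded_operator_on_def)

lemma bounded_operator_diff:
  assumes "bounded_operator_on K B" "f \<in> K" "g \<in> K"
  shows "B (f - g) = B f - B g"
proof -
  have "cscale (- 1) g \<in> K"
    using assms(3) complex_subspace_K by (auto simp: complex_subspace_def)
  with assms show ?thesis
    unfolding bounded_operator_on_def diff_conv_add_uminus uminus_eq_cscale by metis
qed

lemma bounded_operator_bound: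
  assumes "bounded_operator_on K B"
  obtains M where "M \<ge> 0" "\<And>f. f \<in> K \<Longrightarrow> norm (B f) \<le> M * norm f"
proof -
  obtain M where M: "\<forall>f\<in>K. norm (B f) \<le> M * norm f"
    using assms by (auto simp: bounded_operator_on_def)
  have "norm (B f) \<le> \<bar>M\<bar> * norm f" if "f \<in> K" for f
    using M that mult_right_mono[OF abs_ge_self[of M] norm_ge_zero[of f]] by (blast intro: order_trans)
  then show ?thesis using that[of "\<bar>M\<bar>"] by simp
qed

lemma A_seq_eq: "f \<in> K \<Longrightarrow> A_seq n f = (backward_shift ^^ n) (A ((T ^^ n) f))"
  by (simp add: compressed_shift_adj_pow A_in_K T_pow_in_K)

lemma norm_A_seq_le: "f \<in> K \<Longrightarrow> norm (A_seq n f) \<le> norm (A ((T ^^ n) f))"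
  unfolding A_seq_eq by (rule norm_backward_shift_pow_le)

lemma A_seq_tendsto_iff:
  assumes "bounded_operator_on K B"
  shows "op_norm_tendsto_on K A_seq B \<longleftrightarrow>
    (\<forall>e>0. \<exists>N. \<forall>n\<ge>N. \<forall>f\<in>K. norm f \<le> 1 \<longrightarrow> norm (A_seq n f - B f) \<le> e)"
proof (rule op_norm_tendsto_on_iff[OF zero_in_K])
  fix n
  obtain M where M: "M \<ge> 0" "\<And>f. f \<in> K \<Longrightarrow> norm (A f) \<le> M * norm f"
    using bounded_operator_bound[OF A] by blast
  obtain M' where M': "M' \<ge> 0" "\<And>f. f \<in> K \<Longrightarrow> norm (B f) \<le> M' * norm f"
    using bounded_operator_bound[OF assms] by blast
  have "norm (A_seq n f - B f) \<le> M + M'" if f: "f \<in> K" "norm f \<le> 1" for f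
  proof -
    have "norm (A_seq n f) \<le> M * norm ((T ^^ n) f)"
      using norm_A_seq_le[OF f(1), of n] M(2)[OF T_pow_in_K[OF f(1), of n]] by linarith
    also have "\<dots> \<le> M"
      using norm_T_pow_le[of n f] f(2) M(1) by (intro mult_left_le) auto
    finally have "norm (A_seq n f) \<le> M" .
    moreover have "norm (B f) \<le> M'"
      using M'(2)[OF f(1)] mult_left_le[OF f(2) M'(1)] by linarith
    ultimately show ?thesis
      using norm_triangle_ineq4[of "A_seq n f" "B f"] by linarith
  qed
  then show "\<exists>C. \<forall>f\<in>K. norm f \<le> 1 \<longrightarrow> norm (A_seq n f - B f) \<le> C" by blast
qed

lemma bounded_operator_zero: "bounded_operator_on K (\<lambda>_. 0)"
  by (auto simp: bounded_operator_on_def intro: exI[of _ 0])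

lemma limit_eq_0:
  assumes B: "bounded_operator_on K B" and lim: "op_norm_tendsto_on K A_seq B" and f: "f \<in> K"
  shows "B f = 0"
proof -
  have zero: "B f = 0" if f: "f \<in> K" "norm f \<le> 1" for f
  proof (rule LIMSEQ_unique)
    obtain M where M: "M \<ge> 0" "\<And>f. f \<in> K \<Longrightarrow> norm (A f) \<le> M * norm f"
      using bounded_operator_bound[OF A] by blast
    show "(\<lambda>n. A_seq n f) \<longlonglongrightarrow> B f"
    proof (rule LIMSEQ_I)
      fix e :: real assume "e > 0"
      then obtain N where N: "\<forall>n\<ge>N. \<forall>f\<in>K. norm f \<le> 1 \<longrightarrow> norm (A_seq n f - B f) \<le> e / 2"
        using lim half_gt_zero unfolding A_seq_tendsto_iff[OF B] by blast
      have "norm (A_seq n f - B f) < e" if "n \<ge> N" for n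
        using N that f \<open>e > 0\<close> by fastforce
      then show "\<exists>N. \<forall>n\<ge>N. norm (A_seq n f - B f) < e" by blast
    qed
    show "(\<lambda>n. A_seq n f) \<longlonglongrightarrow> 0"
    proof (rule Lim_null_comparison)
      show "\<forall>\<^sub>F n in sequentially. norm (A_seq n f) \<le> M * norm ((T ^^ n) f)"
        using norm_A_seq_le[OF f(1)] M(2)[OF T_pow_in_K[OF f(1)]]
        by (intro always_eventually allI) (rule order_trans)
      have "(\<lambda>n. M * norm ((T ^^ n) f)) \<longlonglongrightarrow> M * norm (0 :: L2_circle)"
        by (intro tendsto_intros T_pow_tendsto_0 f)
      then show "(\<lambda>n. M * norm ((T ^^ n) f)) \<longlonglongrightarrow> 0" by simp
    qed
  qed
  \<comment> \<open>Operator norm convergence speaks of the unit ball only, so \<open>f\<close> is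
    scaled into it; the summand 1 keeps the factor meaningful at \<open>f\<close> = 0.\<close>
  define d where "d = inverse (norm f + 1)"
  define c where "c = complex_of_real d"
  have "norm f + 1 > 0"
    by (simp add: add_nonneg_pos)
  then have "d > 0" "d * norm f \<le> 1"
    by (simp_all add: d_def field_simps)
  then have c: "c \<noteq> 0" "norm (cscale c f) \<le> 1"
    by (simp_all add: c_def)
  have "cscale c f \<in> K"
    using complex_subspace_K f by (simp add: complex_subspace_def)
  with c(2) have "B (cscale c f) = 0" by (intro zero)
  then have "cscale (inverse c) (cscale c (B f)) = 0"
    using B f by (simp add: bounded_operator_on_def)
  then show ?thesis using c(1) by simp
qed

lemma tendsto_0_if_converges:
  assumes B: "bounded_operator_on K B" and lim: "op_norm_tendsto_on K A_seq B"
  shows "op_norm_tendsto_on K A_seq (\<lambda>_. 0)"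
  using lim limit_eq_0[OF B lim]
  unfolding A_seq_tendsto_iff[OF B] A_seq_tendsto_iff[OF bounded_operator_zero] by simp

text \<open>Contractions that tend strongly to 0 do so uniformly on compact sets, by a finite net.
  Since \<open>T ^^ n\<close> is a contraction, \<open>A\<close> is evaluated only on the unit ball,
  for every \<open>n\<close>.\<close>

lemma tendsto_0_if_compact:
  assumes "compact_operator_on K A"
  shows "op_norm_tendsto_on K A_seq (\<lambda>_. 0)"
  unfolding A_seq_tendsto_iff[OF bounded_operator_zero]
proof (intro allI impI)
  fix e :: real assume "e > 0"
  define S where "S = closure (A ` {f\<in>K. norm f \<le> 1})"
  have "compact S"
    using assms by (simp add: compact_operator_on_def S_def)
  moreover have "S \<subseteq> K"
    unfolding S_def by (rule closure_minimal) (auto intro: A_in_K closed_K)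
  \<comment> \<open>The centres of the net are taken inside \<open>S\<close>, hence in
    \<open>K\<close>, so that the backward shift powers tend to 0 at each of them.\<close>
  moreover obtain k where k: "finite k" "k \<subseteq> S" "S \<subseteq> (\<Union>x\<in>k. ball x (e / 2))"
    using seq_compact_imp_totally_bounded[of S] \<open>compact S\<close> \<open>e > 0\<close>
    by (meson compact_eq_seq_compact_metric half_gt_zero)
  ultimately have "\<forall>x\<in>k. \<forall>\<^sub>F n in sequentially. norm ((backward_shift ^^ n) x) < e / 2"
    using backward_shift_pow_tendsto_0 K_subset \<open>e > 0\<close>
    by (intro ballI order_tendstoD(2)[OF tendsto_norm_zero]) auto
  with k(1) have "\<forall>\<^sub>F n in sequentially. \<forall>x\<in>k. norm ((backward_shift ^^ n) x) < e / 2"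
    by (rule eventually_ball_finite)
  then obtain N where N: "\<And>n x. n \<ge> N \<Longrightarrow> x \<in> k \<Longrightarrow> norm ((backward_shift ^^ n) x) < e / 2"
    unfolding eventually_sequentially by blast
  have "norm (A_seq n f - 0) \<le> e" if n: "n \<ge> N" and f: "f \<in> K" "norm f \<le> 1" for n f
  proof -
    define y where "y = A ((T ^^ n) f)"
    have "norm ((T ^^ n) f) \<le> 1"
      using norm_T_pow_le[of n f] f(2) by linarith
    then have "y \<in> S"
      unfolding S_def y_def using T_pow_in_K[OF f(1)] by (intro subsetD[OF closure_subset]) auto
    then obtain x where x: "x \<in> k" "norm (y - x) < e / 2"
      using k(3) by (auto simp: dist_norm norm_minus_commute)
    have "(backward_shift ^^ n) y = (backward_shift ^^ n) x + (backward_shift ^^ n) (y - x)"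
      by (simp add: linear_diff[OF linear_backward_shift_pow])
    then have "norm ((backward_shift ^^ n) y) \<le>
        norm ((backward_shift ^^ n) x) + norm ((backward_shift ^^ n) (y - x))"
      by (simp only: norm_triangle_ineq)
    then show ?thesis
      using N[OF n x(1)] norm_backward_shift_pow_le[of n "y - x"] x(2)
      unfolding A_seq_eq[OF f(1)] y_def[symmetric] by simp
  qed
  then show "\<exists>N. \<forall>n\<ge>N. \<forall>f\<in>K. norm f \<le> 1 \<longrightarrow> norm (A_seq n f - 0) \<le> e" by blast
qed

lemma continuous_on_A: "continuous_on K A"
proof (rule continuous_onI)
  fix x and e :: real assume x: "x \<in> K" and "e > 0"
  obtain M where M: "M \<ge> 0" "\<And>f. f \<in> K \<Longrightarrow> norm (A f) \<le> M * norm f"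
    using bounded_operator_bound[OF A] by blast
  have "dist (A y) (A x) \<le> e" if "y \<in> K" "dist y x < e / (M + 1)" for y
  proof -
    have "dist (A y) (A x) \<le> M * dist y x"
      using M(2)[OF diff_in_K[OF that(1) x]] bounded_operator_diff[OF A that(1) x] by (simp add: dist_norm)
    also have "\<dots> \<le> (M + 1) * (e / (M + 1))"
      using that(2) M(1) by (intro mult_mono) auto
    also have "\<dots> = e" using M(1) by simp
    finally show ?thesis .
  qed
  then show "\<exists>d>0. \<forall>y\<in>K. dist y x < d \<longrightarrow> dist (A y) (A x) \<le> e"
    using M(1) \<open>e > 0\<close> by (intro exI[of _ "e / (M + 1)"]) auto
qed

text \<open>With \<open>Q = T\<^sup>n T\<^sup>*\<^sup>n\<close> and \<open>I - Q\<close> of finite rank,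
  \<open>A = (I - Q) A + Q A (I - Q) + Q A Q\<close>, whose last term is small.\<close>

lemma compact_if_tendsto_0:
  assumes "op_norm_tendsto_on K A_seq (\<lambda>_. 0)"
  shows "compact_operator_on K A"
  unfolding compact_operator_on_def
proof (intro conjI A compact_closure_approx)
  fix e :: real assume "e > 0"
  then obtain n where n: "\<And>f. f \<in> K \<Longrightarrow> norm f \<le> 1 \<Longrightarrow> norm (A_seq n f) \<le> e"
    using assms unfolding A_seq_tendsto_iff[OF bounded_operator_zero] diff_0_right by blast
  define Q where "Q x = (T ^^ n) ((backward_shift ^^ n) x)" for x
  have bl_Q: "bounded_linear Q"
    using bounded_linear_compose[OF bounded_linear_T_pow bounded_linear_backward_shift_pow]
    by (simp add: Q_def[abs_def])
  have Q_in_K: "x \<in> K \<Longrightarrow> Q x \<in> K" for x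
    unfolding Q_def by (intro T_pow_in_K backward_shift_pow_in_K)
  obtain M where M: "M \<ge> 0" "\<And>f. f \<in> K \<Longrightarrow> norm (A f) \<le> M * norm f"
    using bounded_operator_bound[OF A] by blast
  \<comment> \<open>The radius is \<open>M\<close> because this defect is taken of
    \<open>A f\<close>, whose norm is at most \<open>M\<close>.\<close>
  obtain C where C: "compact C" "\<And>f. f \<in> K \<Longrightarrow> norm f \<le> M \<Longrightarrow> defect n f \<in> C"
    using defect_compact[of M n] by blast
  obtain D where D: "compact D" "\<And>f. f \<in> K \<Longrightarrow> norm f \<le> 1 \<Longrightarrow> defect n f \<in> D"
    using defect_compact[of 1 n] by blast
  \<comment> \<open>\<open>A\<close> is continuous on \<open>K\<close> only; the intersection with
    the closed set \<open>K\<close> remains compact and still contains the defects.\<close>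
  define D' where "D' = Q ` A ` (D \<inter> K)"
  have "compact D'"
    unfolding D'_def
    by (intro compact_continuous_image linear_continuous_on bl_Q continuous_on_subset[OF continuous_on_A]
        compact_Int_closed D closed_K) auto
  then have "compact {x + y |x y. x \<in> C \<and> y \<in> D'}"
    by (intro compact_sums C)
  moreover have "\<exists>c\<in>{x + y |x y. x \<in> C \<and> y \<in> D'}. dist (A f) c \<le> e" if f: "f \<in> K" "norm f \<le> 1" for f
  proof -
    let ?c = "defect n (A f) + Q (A (defect n f))"
    have "norm (A f) \<le> M"
      using M(2)[OF f(1)] mult_left_le[OF f(2) M(1)] by linarith
    then have "defect n (A f) \<in> C"
      using f(1) by (intro C(2) A_in_K)
    moreover have "Q (A (defect n f)) \<in> D'"
      unfolding D'_def using D(2)[OF f] defect_in_K[OF f(1)] by blast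
    moreover have "A f - ?c = Q (A (Q f))"
    proof -
      have "A (defect n f) = A f - A (Q f)"
        unfolding defect_def Q_def[symmetric] by (rule bounded_operator_diff[OF A f(1) Q_in_K[OF f(1)]])
      then show ?thesis
        by (simp add: linear_diff[OF bounded_linear.linear[OF bl_Q]])
           (simp add: defect_def Q_def)
    qed
    then have "dist (A f) ?c = norm (Q (A (Q f)))"
      by (simp add: dist_norm)
    \<comment> \<open>Regrouping: the backward shifts of the outer \<open>Q\<close>, then
      \<open>A\<close>, then the powers of \<open>T\<close> of the inner \<open>Q\<close> form
      \<open>A_seq n\<close>. What stands on either side is a contraction.\<close>
    moreover have "Q (A (Q f)) = (T ^^ n) (A_seq n ((backward_shift ^^ n) f))"
      unfolding A_seq_eq[OF backward_shift_pow_in_K[OF f(1)]] by (simp add: Q_def)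
    moreover have "norm (A_seq n ((backward_shift ^^ n) f)) \<le> e"
      using f norm_backward_shift_pow_le[of n f] by (intro n backward_shift_pow_in_K) auto
    ultimately show ?thesis
      using norm_T_pow_le[of n "A_seq n ((backward_shift ^^ n) f)"]
      by (intro bexI[of _ ?c]) auto
  qed
  ultimately show "\<exists>C. compact C \<and> (\<forall>x\<in>A ` {f\<in>K. norm f \<le> 1}. \<exists>c\<in>C. dist x c \<le> e)"
    by (intro exI[of _ "{x + y |x y. x \<in> C \<and> y \<in> D'}"] conjI ballI) blast+
qed

end

theorem theorem1p2:
  fixes \<Theta> :: "complex \<Rightarrow> complex" and A :: "L2_circle \<Rightarrow> L2_circle"
  assumes "inner_function \<Theta>"
    and "bounded_operator_on (model_space \<Theta>) A"
  shows "((\<exists>B. bounded_operator_on (model_space \<Theta>) B \<and>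
            op_norm_tendsto_on (model_space \<Theta>)
              (\<lambda>n. (compressed_shift_adj \<Theta> ^^ n) \<circ> A \<circ> (compressed_shift \<Theta> ^^ n)) B)
          \<longleftrightarrow>
          op_norm_tendsto_on (model_space \<Theta>)
            (\<lambda>n. (compressed_shift_adj \<Theta> ^^ n) \<circ> A \<circ> (compressed_shift \<Theta> ^^ n)) (\<lambda>_. 0))
       \<and> (op_norm_tendsto_on (model_space \<Theta>)
            (\<lambda>n. (compressed_shift_adj \<Theta> ^^ n) \<circ> A \<circ> (compressed_shift \<Theta> ^^ n)) (\<lambda>_. 0)
          \<longleftrightarrow>
          compact_operator_on (model_space \<Theta>) A)"
proof -
  interpret model_operator \<Theta> A
    using assms by unfold_locales
  show ?thesis
    using tendsto_0_if_converges bounded_operator_zero tendsto_0_if_compact compact_if_tendsto_0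
    by blast
qed

end
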